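(* Let $\lambda_{BS}>0$, $p\in(0,1]$, $P_{macro}>0$, $P_{micro}\ge0$, $\beta>2$, $\lambda_{SU},\lambda_L,\lambda_{MU}>0$. Let $\Phi_{macro},\Phi_{micro}$ be independent homogeneous Poisson point processes on $\mathbb{R}^2$ of intensities $p\lambda_{BS}$ and $(1-p)\lambda_{BS}$; $\mathcal{U}_{static}$ a homogeneous Poisson point process of intensity $\lambda_{SU}$; $\mathcal{L}$ a homogeneous directed Poisson line process of intensity $\lambda_L$ (mean line length per unit area) and, given $\mathcal{L}$, $\mathcal{U}_{mobile}$ a Poisson process on the lines of $\mathcal{L}$ of linear intensity $\lambda_{MU}$; all independent. Let $X^*$ be the point of $\Phi_{macro}$ closest to the origin, $V_{macro}(0)$ its Voronoi cell w.r.t. $\Phi_{macro}$, $V_{het}(X^* )$ its hetnet cell, and $V_{het}(0)$ the hetnet cell containing the origin. Define $$\overline N_{SU,macro}=\mathbf{E}[|\mathcal{U}_{static}(V_{het}(X^* ))|],\qquad \overline N_{MU,het}=\mathbf{E}\big[|\mathcal{U}_{mobile}(V_{macro}(0))|\,\mathbf{1}(V_{het}(0)=V_{het}(X^* ))\big].$$ Then $\overline N_{MU,het}=\dfrac{\lambda_L\lambda_{MU}}{\lambda_{SU}}\overline N_{SU,macro}$.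
   Context: With $\Phi=\Phi_{macro}\cup\Phi_{micro}$ and $P_i=P_{macro}$ for macro stations, $P_i=P_{micro}$ for micro stations, the hetnet cell of a station $X_i\in\Phi$ is the set of $z\in\mathbb{R}^2$ with $P_i|X_i-z|^{-\beta}\ge P_j|X_j-z|^{-\beta}$ for all $X_j\in\Phi$. Static users are served by the station whose hetnet cell contains them; mobile users only by the closest macro station. $\overline N_{MU,het}$ is the mean number of mobile users sharing the station serving a typical static user at the origin (the expectation under the Palm distribution of static users coincides with $\mathbf{E}$ by independence). *)

theory Defs
  imports "HOL-Probability.Probability"
begin

type_synonym point = "real \<times> real"

(* Poisson probability with mean r (0^0 = 1 convention, so r = 0 gives the Dirac mass at 0) *)
definition poisson_prob :: "real \<Rightarrow> nat \<Rightarrow> real" where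
  "poisson_prob r k = exp (- r) * r ^ k / fact k"

definition count_events :: "'w measure \<Rightarrow> ('w \<Rightarrow> 'a::euclidean_space set) \<Rightarrow> 'w set set" where
  "count_events M \<Phi> =
     {{\<omega> \<in> space M. \<forall>i<n. card (\<Phi> \<omega> \<inter> A i) = k i} | (n::nat) A k.
        \<forall>i<n. A i \<in> sets borel \<and> bounded (A i)}"

definition joint_count_events ::
  "'w measure \<Rightarrow> ('w \<Rightarrow> 'a::euclidean_space set) \<Rightarrow> ('w \<Rightarrow> 'b::euclidean_space set) \<Rightarrow> 'w set set" where
  "joint_count_events M \<Phi> \<Psi> =
     {{\<omega> \<in> space M. (\<forall>i<n. card (\<Phi> \<omega> \<inter> A i) = k i) \<and> (\<forall>i<m. card (\<Psi> \<omega> \<inter> B i) = l i)}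
        | (n::nat) A k (m::nat) B l.
        (\<forall>i<n. A i \<in> sets borel \<and> bounded (A i)) \<and> (\<forall>i<m. B i \<in> sets borel \<and> bounded (B i))}"

definition point_process :: "'w measure \<Rightarrow> ('w \<Rightarrow> 'a::euclidean_space set) \<Rightarrow> bool" where
  "point_process M \<Phi> \<longleftrightarrow>
     (\<forall>\<omega>\<in>space M. \<forall>A. bounded A \<longrightarrow> finite (\<Phi> \<omega> \<inter> A)) \<and>
     (\<forall>A k. A \<in> sets borel \<and> bounded A \<longrightarrow> {\<omega> \<in> space M. card (\<Phi> \<omega> \<inter> A) = k} \<in> sets M)"

definition poisson_pp :: "'w measure \<Rightarrow> ('w \<Rightarrow> 'a::euclidean_space set) \<Rightarrow> ('a set \<Rightarrow> real) \<Rightarrow> bool" where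
  "poisson_pp M \<Phi> mu \<longleftrightarrow> point_process M \<Phi> \<and>
     (\<forall>(n::nat) A k. (\<forall>i<n. A i \<in> sets borel \<and> bounded (A i)) \<and> disjoint_family_on A {..<n} \<longrightarrow>
        measure M {\<omega> \<in> space M. \<forall>i<n. card (\<Phi> \<omega> \<inter> A i) = k i}
          = (\<Prod>i<n. poisson_prob (mu (A i)) (k i)))"

definition hom_ppp :: "'w measure \<Rightarrow> ('w \<Rightarrow> point set) \<Rightarrow> real \<Rightarrow> bool" where
  "hom_ppp M \<Phi> lam \<longleftrightarrow> poisson_pp M \<Phi> (\<lambda>A. lam * measure lborel A)"

(* A directed line is encoded by (theta, r) with theta in [0, 2 pi), r real:
   the line {z. z . (cos theta, sin theta) = r}, traversed in direction (-sin theta, cos theta). *)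
definition line_pt :: "real \<times> real \<Rightarrow> real \<Rightarrow> point" where
  "line_pt l t = (snd l * cos (fst l) - t * sin (fst l), snd l * sin (fst l) + t * cos (fst l))"

definition line_set :: "real \<times> real \<Rightarrow> point set" where
  "line_set l = range (line_pt l)"

definition line_len :: "real \<times> real \<Rightarrow> point set \<Rightarrow> real" where
  "line_len l A = measure lborel {t. line_pt l t \<in> A}"

definition lines_len :: "(real \<times> real) set \<Rightarrow> point set \<Rightarrow> real" where
  "lines_len L A = (\<Sum>l\<in>{l\<in>L. line_set l \<inter> A \<noteq> {}}. line_len l A)"

(* homogeneous directed Poisson line process of intensity lamL (mean line length per unit area):
   Poisson process of line parameters on [0,2pi) x R with intensity measure (lamL/(2 pi)) d theta dr *)
definition hom_plp :: "'w measure \<Rightarrow> ('w \<Rightarrow> (real \<times> real) set) \<Rightarrow> real \<Rightarrow> bool" where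
  "hom_plp M L lamL \<longleftrightarrow>
     poisson_pp M L (\<lambda>A. lamL / (2 * pi) * measure lborel (A \<inter> ({0..<2 * pi} \<times> UNIV)))"

definition cox_on_lines :: "'w measure \<Rightarrow> ('w \<Rightarrow> (real \<times> real) set) \<Rightarrow> ('w \<Rightarrow> point set) \<Rightarrow> real \<Rightarrow> bool" where
  "cox_on_lines M L U lam \<longleftrightarrow> point_process M U \<and>
     (\<forall>B\<in>count_events M L. \<forall>(n::nat) A k. (\<forall>i<n. A i \<in> sets borel \<and> bounded (A i)) \<and> disjoint_family_on A {..<n} \<longrightarrow>
        emeasure M (B \<inter> {\<omega> \<in> space M. \<forall>i<n. card (U \<omega> \<inter> A i) = k i})
          = (\<integral>\<^sup>+\<omega>. indicator B \<omega> * ennreal (\<Prod>i<n. poisson_prob (lam * lines_len (L \<omega>) (A i)) (k i)) \<partial>M))"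

definition closest :: "point set \<Rightarrow> point" where
  "closest \<Phi> = (SOME x. x \<in> \<Phi> \<and> (\<forall>y\<in>\<Phi>. norm x \<le> norm y))"

definition voronoi :: "point set \<Rightarrow> point \<Rightarrow> point set" where
  "voronoi \<Phi> x = {z. \<forall>y\<in>\<Phi>. dist x z \<le> dist y z}"

definition hpow :: "point set \<Rightarrow> real \<Rightarrow> real \<Rightarrow> point \<Rightarrow> real" where
  "hpow Mac Pmac Pmic x = (if x \<in> Mac then Pmac else Pmic)"

(* hetnet cell of station x: P_x |x-z|^(-beta) >= P_y |y-z|^(-beta) for all stations y,
   written multiplicatively as P_y |x-z|^beta <= P_x |y-z|^beta *)
definition hetcell :: "point set \<Rightarrow> point set \<Rightarrow> real \<Rightarrow> real \<Rightarrow> real \<Rightarrow> point \<Rightarrow> point set" where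
  "hetcell Mac Mic Pmac Pmic \<beta> x =
     {z. \<forall>y\<in>Mac \<union> Mic. hpow Mac Pmac Pmic y * dist x z powr \<beta> \<le> hpow Mac Pmac Pmic x * dist y z powr \<beta>}"

end

theory Submission
  imports Defs "HOL-Real_Asymp.Real_Asymp"
begin

text \<open>Write \<open>V(0)\<close> for the macro Voronoi cell and \<open>H\<close> for the hetnet cell of
  \<open>X\<^sup>*\<close>. Both user processes are independent of the stations
  and have constant intensity, so by Campbell's formula the two sides are
  \<open>lamL * lamMU * \<integral> P(x \<in> V(0) \<and> 0 \<in> H) dx\<close> and
  \<open>lamL * lamMU * \<integral> P(x \<in> H) dx\<close>. The integrands agree for every \<open>x\<close>: the reflection
  \<open>y \<mapsto> x - y\<close> preserves the law of the stations and exchanges the origin with \<open>x\<close>; since a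
  hetnet cell of a macro station lies in its Voronoi cell, it turns the event that \<open>X\<^sup>*\<close> is also
  closest to \<open>x\<close> and serves the origin into the event that \<open>X\<^sup>*\<close> serves \<open>x\<close>.\<close>

section \<open>Sums over the points of a random configuration\<close>

text \<open>Campbell's formula counts points with values up to infinity, while \<open>card\<close>
  of an infinite set is 0, so the formula speaks about the cells only once they are known to contain
  finitely many users almost surely. This comes from an integrable bound: if one macro station is
  nearest to both the origin and \<open>x\<close>, then one of the discs of radius
  \<open>norm x / 2\<close> around these two points contains no macro station, which has probability
  at most twice a Gaussian in \<open>x\<close>. The reflection that exchanges the origin with
  \<open>x\<close> does not in general send the station closest to the origin to the one closest to
  the origin. The events are therefore stated with a quantified station whose Voronoi cell contains
  the origin, and \<open>closest\<close> enters only through an almost sure equivalence. Of the user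
  processes only the first moment matters, so the line structure survives solely in the constant
  \<open>lamL * lamMU\<close>.\<close>

definition locally_finite :: "'a::euclidean_space set \<Rightarrow> bool" where
  "locally_finite \<phi> \<longleftrightarrow> (\<forall>A. bounded A \<longrightarrow> finite (\<phi> \<inter> A))"

text \<open>Generated by the counts in bounded Borel windows, which are the events that
  \<open>point_process\<close> requires. A point process thereby becomes a measurable map, and its
  law a measure on configurations.\<close>

definition conf :: "'a::euclidean_space set measure" where
  "conf = sigma (Collect locally_finite)
     {{\<phi>. locally_finite \<phi> \<and> card (\<phi> \<inter> A) = k} | A k. A \<in> sets borel \<and> bounded A}"

lemma space_conf: "space conf = Collect locally_finite"
  unfolding conf_def by (rule space_measure_of) auto

lemma point_process_iff: "point_process M \<Phi> \<longleftrightarrow> \<Phi> \<in> measurable M conf"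
proof
  assume pp: "point_process M \<Phi>"
  show "\<Phi> \<in> measurable M conf"
    unfolding conf_def
  proof (rule measurable_measure_of)
    show "\<Phi> \<in> space M \<rightarrow> Collect locally_finite"
      using pp by (auto simp: point_process_def locally_finite_def)
    fix Y :: "'b set set"
    assume "Y \<in> {{\<phi>. locally_finite \<phi> \<and> card (\<phi> \<inter> A) = k} | A k. A \<in> sets borel \<and> bounded A}"
    then obtain A k where Y: "Y = {\<phi>. locally_finite \<phi> \<and> card (\<phi> \<inter> A) = k}" "A \<in> sets borel" "bounded A"
      by auto
    then have "\<Phi> -` Y \<inter> space M = {\<omega> \<in> space M. card (\<Phi> \<omega> \<inter> A) = k}"
      using pp by (auto simp: point_process_def locally_finite_def)
    then show "\<Phi> -` Y \<inter> space M \<in> sets M"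
      using pp Y by (auto simp: point_process_def)
  qed auto
next
  assume m: "\<Phi> \<in> measurable M conf"
  have "locally_finite (\<Phi> \<omega>)" if "\<omega> \<in> space M" for \<omega>
    using measurable_space[OF m that] by (simp add: space_conf)
  moreover have "{\<omega> \<in> space M. card (\<Phi> \<omega> \<inter> A) = k} \<in> sets M" if "A \<in> sets borel" "bounded A" for A k
  proof -
    have "{\<phi>. locally_finite \<phi> \<and> card (\<phi> \<inter> A) = k} \<in> sets conf"
      unfolding conf_def by (subst sets_measure_of) (use that in auto)
    from measurable_sets[OF m this] show ?thesis
      by (rule back_subst[of "\<lambda>x. x \<in> sets M"]) (use calculation in auto)
  qed
  ultimately show "point_process M \<Phi>"
    by (auto simp: point_process_def locally_finite_def)
qed

lemma point_process_finite:
  "point_process M U \<Longrightarrow> \<omega> \<in> space M \<Longrightarrow> bounded A \<Longrightarrow> finite (U \<omega> \<inter> A)"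
  by (auto simp: point_process_def)

lemma point_process_card_measurable:
  assumes "point_process M U" "A \<in> sets borel" "bounded A"
  shows "(\<lambda>\<omega>. card (U \<omega> \<inter> A)) \<in> measurable M (count_space UNIV)"
proof (rule measurable_count_space_eq_countable[THEN iffD2])
  show "countable (UNIV :: nat set)" by simp
  have "(\<lambda>\<omega>. card (U \<omega> \<inter> A)) -` {k} \<inter> space M = {\<omega> \<in> space M. card (U \<omega> \<inter> A) = k}" for k
    by auto
  then show "(\<lambda>\<omega>. card (U \<omega> \<inter> A)) \<in> space M \<rightarrow> UNIV \<and>
      (\<forall>a\<in>UNIV. (\<lambda>\<omega>. card (U \<omega> \<inter> A)) -` {a} \<inter> space M \<in> sets M)"
    using assms by (auto simp: point_process_def)
qed

lemma point_process_conf: "point_process conf (\<lambda>\<phi>. \<phi>)"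
  by (simp add: point_process_iff)

lemma nn_integral_count_space_restrict:
  "(\<integral>\<^sup>+x. f x \<partial>count_space (A \<inter> B)) = (\<integral>\<^sup>+x. f x * indicator B x \<partial>count_space A)"
proof -
  have "(\<integral>\<^sup>+x. f x \<partial>count_space (A \<inter> B)) = (\<integral>\<^sup>+x. f x * indicator (A \<inter> B) x \<partial>count_space UNIV)"
    by (rule nn_integral_count_space_indicator) simp
  also have "\<dots> = (\<integral>\<^sup>+x. f x * indicator B x * indicator A x \<partial>count_space UNIV)"
    by (intro nn_integral_cong) (auto simp: indicator_def)
  also have "\<dots> = (\<integral>\<^sup>+x. f x * indicator B x \<partial>count_space A)"
    by (rule nn_integral_count_space_indicator[symmetric]) simp
  finally show ?thesis .
qed

lemma SUP_indicator_ball: "(SUP n::nat. indicator (ball 0 (real n)) x) = (1 :: ennreal)"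
  for x :: "'a::euclidean_space"
proof (rule antisym)
  obtain n :: nat where n: "norm x < real n"
    using reals_Archimedean2 by blast
  then show "1 \<le> (SUP n::nat. indicator (ball 0 (real n)) x :: ennreal)"
    by (intro SUP_upper2[of n]) auto
qed (auto intro!: SUP_least simp: indicator_def)

text \<open>Configurations are only locally finite; balls of integer radius cut them into finite
  pieces, and monotone convergence recovers the full sum.\<close>

lemma nn_integral_count_space_exhaust:
  fixes U :: "'a::euclidean_space set"
  shows "(\<integral>\<^sup>+x. f x \<partial>count_space U) = (SUP n::nat. \<integral>\<^sup>+x. f x \<partial>count_space (U \<inter> ball 0 n))"
proof -
  have "(SUP n::nat. f x * indicator (ball 0 (real n)) x) = f x" for x
    by (simp add: SUP_mult_left_ennreal[symmetric] SUP_indicator_ball)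
  then have "(\<integral>\<^sup>+x. f x \<partial>count_space U)
      = (\<integral>\<^sup>+x. (SUP n::nat. f x * indicator (ball 0 (real n)) x) \<partial>count_space U)"
    by simp
  also have "\<dots> = (SUP n::nat. \<integral>\<^sup>+x. f x * indicator (ball 0 (real n)) x \<partial>count_space U)"
    by (intro nn_integral_monotone_convergence_SUP)
       (auto simp: incseq_def le_fun_def indicator_def)
  finally show ?thesis
    by (simp add: nn_integral_count_space_restrict)
qed

text \<open>Restricting to a bounded window keeps the sums finite, so that the Dynkin argument can
  subtract complements.\<close>

lemma sum_points_window_sets:
  fixes U :: "'w \<Rightarrow> 'a::euclidean_space set"
  assumes U: "point_process M U" and W: "W \<in> sets borel" "bounded W"
    and D: "D \<in> sets (borel \<Otimes>\<^sub>M M)"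
  shows "(\<lambda>\<omega>. \<integral>\<^sup>+x. indicator D (x, \<omega>) \<partial>count_space (U \<omega> \<inter> W)) \<in> borel_measurable M" (is "?m D")
proof -
  have fin: "finite (U \<omega> \<inter> W)" if "\<omega> \<in> space M" for \<omega>
    using point_process_finite[OF U that W(2)] .
  define G where "G = {a \<times> b |a b. a \<in> sets (borel :: 'a measure) \<and> b \<in> sets M}"
  have D': "D \<in> sigma_sets (UNIV \<times> space M) G"
    using D by (simp add: sets_pair_measure G_def)
  have "Int_stable G" "G \<subseteq> Pow (UNIV \<times> space M)"
    using sets.space_closed by (auto simp: G_def Int_stable_pair_measure_generator)
  then show ?thesis using D'
  proof (induct rule: sigma_sets_induct_disjoint)
    case (basic D)
    then obtain a b where ab: "D = a \<times> b" "a \<in> sets borel" "b \<in> sets M" by (auto simp: G_def)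
    have "(\<integral>\<^sup>+x. indicator D (x, \<omega>) \<partial>count_space (U \<omega> \<inter> W)) = of_nat (card (U \<omega> \<inter> (W \<inter> a))) * indicator b \<omega>"
      if "\<omega> \<in> space M" for \<omega>
      using fin[OF that] by (simp add: nn_integral_count_space_finite ab indicator_times sum_distrib_right[symmetric] indicator_def
         sum.If_cases Int_assoc)
    moreover have "(\<lambda>\<omega>. of_nat (card (U \<omega> \<inter> (W \<inter> a))) * indicator b \<omega> :: ennreal) \<in> borel_measurable M"
    proof -
      have [measurable]: "b \<in> sets M" by fact
      have [measurable]: "(\<lambda>\<omega>. card (U \<omega> \<inter> (W \<inter> a))) \<in> measurable M (count_space UNIV)"
        using point_process_card_measurable[OF U, of "W \<inter> a"] W ab by auto
      show ?thesis by measurable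
    qed
    ultimately show ?case by (simp cong: measurable_cong)
  next
    case empty
    then show ?case by simp
  next
    case (compl A)
    have "(\<integral>\<^sup>+x. indicator (UNIV \<times> space M - A) (x, \<omega>) \<partial>count_space (U \<omega> \<inter> W))
        = of_nat (card (U \<omega> \<inter> W)) - (\<integral>\<^sup>+x. indicator A (x, \<omega>) \<partial>count_space (U \<omega> \<inter> W))"
      if "\<omega> \<in> space M" for \<omega>
    proof -
      have "of_nat (card (U \<omega> \<inter> W)) = (\<integral>\<^sup>+x. indicator (UNIV \<times> space M - A) (x, \<omega>) + indicator A (x, \<omega>) \<partial>count_space (U \<omega> \<inter> W))"
      proof -
        have "indicator (UNIV \<times> space M - A) (x, \<omega>) + indicator A (x, \<omega>) = (1 :: ennreal)" for x
          using that by (simp add: indicator_def)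
        then show ?thesis using fin[OF that] by (simp add: nn_integral_count_space_finite)
      qed
      also have "\<dots> = (\<integral>\<^sup>+x. indicator (UNIV \<times> space M - A) (x, \<omega>) \<partial>count_space (U \<omega> \<inter> W))
           + (\<integral>\<^sup>+x. indicator A (x, \<omega>) \<partial>count_space (U \<omega> \<inter> W))"
        by (rule nn_integral_add) auto
      finally have *: "of_nat (card (U \<omega> \<inter> W)) = \<dots>" .
      moreover have "(\<integral>\<^sup>+x. indicator A (x, \<omega>) \<partial>count_space (U \<omega> \<inter> W)) \<noteq> \<infinity>"
        using fin[OF that] by (simp add: nn_integral_count_space_finite indicator_def)
      ultimately show ?thesis by (metis ennreal_add_diff_cancel_right infinity_ennreal_def)
    qed
    moreover have "(\<lambda>\<omega>. of_nat (card (U \<omega> \<inter> W)) - (\<integral>\<^sup>+x. indicator A (x, \<omega>) \<partial>count_space (U \<omega> \<inter> W))) \<in> borel_measurable M"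
      using point_process_card_measurable[OF U W] compl by measurable
    ultimately show ?case by (simp cong: measurable_cong)
  next
    case (union A)
    have "(\<integral>\<^sup>+x. indicator (\<Union>i. A i) (x, \<omega>) \<partial>count_space (U \<omega> \<inter> W))
       = (\<Sum>i. \<integral>\<^sup>+x. indicator (A i) (x, \<omega>) \<partial>count_space (U \<omega> \<inter> W))" for \<omega>
      using union(1) by (subst nn_integral_suminf[symmetric]) (auto simp: suminf_indicator)
    then show ?case using union by simp
  qed
qed

text \<open>The summand may itself depend on \<omega>. The cell predicates need this, since there
  each point is compared with other random data.\<close>

lemma sum_points_measurable:
  fixes U :: "'w \<Rightarrow> 'a::euclidean_space set" and f :: "'a \<times> 'w \<Rightarrow> ennreal"
  assumes U: "point_process M U" and f: "f \<in> borel_measurable (borel \<Otimes>\<^sub>M M)"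
  shows "(\<lambda>\<omega>. \<integral>\<^sup>+x. f (x, \<omega>) \<partial>count_space (U \<omega>)) \<in> borel_measurable M"
  using f
proof induction
  case (cong f g)
  have "(\<integral>\<^sup>+x. f (x, \<omega>) \<partial>count_space (U \<omega>)) = (\<integral>\<^sup>+x. g (x, \<omega>) \<partial>count_space (U \<omega>))" if "\<omega> \<in> space M" for \<omega>
    by (intro nn_integral_cong cong) (simp add: space_pair_measure that)
  with cong show ?case by (simp cong: measurable_cong)
next
  case (set A)
  then show ?case
    by (subst nn_integral_count_space_exhaust)
       (intro borel_measurable_SUP sum_points_window_sets[OF U]; simp)
next
  case (mult u c)
  then show ?case by (simp add: nn_integral_cmult)
next
  case (add u v)
  then show ?case by (simp add: nn_integral_add)
next
  case (seq F)
  have "(\<integral>\<^sup>+x. (SUP i. F i) (x, \<omega>) \<partial>count_space (U \<omega>)) = (SUP i. \<integral>\<^sup>+x. F i (x, \<omega>) \<partial>count_space (U \<omega>))" for \<omega>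
    unfolding SUP_apply using seq(3)
    by (intro nn_integral_monotone_convergence_SUP) (auto simp: incseq_def le_fun_def)
  with seq show ?case by simp
qed

section \<open>Campbell's formula with an independent mark\<close>

lemma nn_integral_of_nat:
  assumes [measurable]: "N \<in> measurable M (count_space UNIV)"
  shows "(\<integral>\<^sup>+\<omega>. of_nat (N \<omega>) \<partial>M) = (\<Sum>k. of_nat k * emeasure M {\<omega> \<in> space M. N \<omega> = k})"
proof -
  have *: "(of_nat (n::nat) :: ennreal) = (\<Sum>k. of_nat k * indicator {k} n)" for n
    by (subst suminf_finite[where N="{n}"]) auto
  have "(\<integral>\<^sup>+\<omega>. of_nat (N \<omega>) \<partial>M) = (\<integral>\<^sup>+\<omega>. (\<Sum>k. of_nat k * indicator {\<omega>\<in>space M. N \<omega> = k} \<omega>) \<partial>M)"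
    by (subst *) (auto intro!: nn_integral_cong simp: indicator_def)
  then show ?thesis
    by (simp add: nn_integral_suminf nn_integral_cmult)
qed

text \<open>\<nu> is the intensity measure of \<open>U\<close>. Independence is asked only between a
  single count and the mark, because on a rectangle \<open>a \<times> b\<close> the sum over the
  points in a window \<open>W\<close> sees \<open>U\<close> only through the count in
  \<open>W \<inter> a\<close>. For the users the mark is the pair of station configurations.\<close>

locale independent_mark = prob_space M + nu: sigma_finite_measure \<nu>
  for M :: "'w measure" and U :: "'w \<Rightarrow> 'a::euclidean_space set"
    and X :: "'w \<Rightarrow> 'b" and N :: "'b measure" and \<nu> :: "'a measure" +
  assumes U: "point_process M U" and X: "X \<in> measurable M N"
    and sets_nu: "sets \<nu> = sets borel"
    and mean: "A \<in> sets borel \<Longrightarrow> bounded A \<Longrightarrow> (\<integral>\<^sup>+\<omega>. of_nat (card (U \<omega> \<inter> A)) \<partial>M) = emeasure \<nu> A"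
    and fin: "A \<in> sets borel \<Longrightarrow> bounded A \<Longrightarrow> emeasure \<nu> A < \<infinity>"
    and indep: "A \<in> sets borel \<Longrightarrow> bounded A \<Longrightarrow> E \<in> sets N \<Longrightarrow>
       measure M {\<omega> \<in> space M. card (U \<omega> \<inter> A) = k \<and> X \<omega> \<in> E}
         = measure M {\<omega> \<in> space M. card (U \<omega> \<inter> A) = k} * measure M {\<omega> \<in> space M. X \<omega> \<in> E}"
begin

text \<open>On rectangles both sides factor, by independence on the left and by the product form on
  the right. Both are additive in \<open>D\<close>, and the window keeps the total mass finite, so
  the equality extends by a Dynkin argument.\<close>

lemma campbell_window_sets:
  assumes W: "W \<in> sets borel" "bounded W" and D: "D \<in> sets (borel \<Otimes>\<^sub>M N)"
  shows "(\<integral>\<^sup>+\<omega>. \<integral>\<^sup>+x. indicator D (x, X \<omega>) \<partial>count_space (U \<omega> \<inter> W) \<partial>M)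
       = (\<integral>\<^sup>+x. indicator W x * (\<integral>\<^sup>+\<omega>. indicator D (x, X \<omega>) \<partial>M) \<partial>\<nu>)"
proof -
  note [measurable] = X
  have [measurable_cong]: "sets \<nu> = sets borel" by (rule sets_nu)
  have [measurable]: "W \<in> sets borel" by fact
  have finU: "finite (U \<omega> \<inter> W)" if "\<omega> \<in> space M" for \<omega>
    using point_process_finite[OF U that W(2)] .
  define lhs where "lhs D = (\<integral>\<^sup>+\<omega>. \<integral>\<^sup>+x. indicator D (x, X \<omega>) \<partial>count_space (U \<omega> \<inter> W) \<partial>M)" for D
  define rhs where "rhs D = (\<integral>\<^sup>+x. indicator W x * (\<integral>\<^sup>+\<omega>. indicator D (x, X \<omega>) \<partial>M) \<partial>\<nu>)" for D
  have meas[measurable]: "(\<lambda>\<omega>. \<integral>\<^sup>+x. indicator D (x, X \<omega>) \<partial>count_space (U \<omega> \<inter> W)) \<in> borel_measurable M"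
    if [measurable]: "D \<in> sets (borel \<Otimes>\<^sub>M N)" for D
  proof -
    have "(\<lambda>(x, \<omega>). (x, X \<omega>)) -` D \<inter> space (borel \<Otimes>\<^sub>M M) \<in> sets (borel \<Otimes>\<^sub>M M)"
      by measurable
    from sum_points_window_sets[OF U W this] show ?thesis
      by (rule measurable_cong[THEN iffD1, rotated])
         (auto intro!: nn_integral_cong simp: indicator_def space_pair_measure)
  qed
  define G where "G = {a \<times> b |a b. a \<in> sets (borel :: 'a measure) \<and> b \<in> sets N}"
  have D': "D \<in> sigma_sets (UNIV \<times> space N) G"
    using D by (simp add: sets_pair_measure G_def)
  have G_eq: "sigma_sets (UNIV \<times> space N) G = sets (borel \<Otimes>\<^sub>M N)"
    by (simp add: sets_pair_measure G_def)
  have rect: "lhs (a \<times> b) = rhs (a \<times> b)" if a[measurable]: "a \<in> sets borel" and b[measurable]: "b \<in> sets N" for a b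
  proof -
    have [measurable]: "(\<lambda>\<omega>. card (U \<omega> \<inter> (W \<inter> a))) \<in> measurable M (count_space UNIV)"
      using point_process_card_measurable[OF U, of "W \<inter> a"] W by auto
    have bW: "W \<inter> a \<in> sets borel" "bounded (W \<inter> a)" using W by auto
    \<comment> \<open>Independence is known for the events that a count equals \<open>k\<close>,
      hence the count is decomposed into its levels.\<close>
    have *: "(of_nat (n::nat) :: ennreal) = (\<Sum>k. of_nat k * indicator {k} n)" for n
      by (subst suminf_finite[where N="{n}"]) auto
    have "lhs (a \<times> b) = (\<integral>\<^sup>+\<omega>. of_nat (card (U \<omega> \<inter> (W \<inter> a))) * indicator b (X \<omega>) \<partial>M)"
      unfolding lhs_def using finU
      by (intro nn_integral_cong) (simp add: nn_integral_count_space_finite indicator_times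
          sum_distrib_right[symmetric] indicator_def sum.If_cases Int_assoc)
    also have "\<dots> = (\<integral>\<^sup>+\<omega>. (\<Sum>k. of_nat k * indicator {\<omega>\<in>space M. card (U \<omega> \<inter> (W \<inter> a)) = k \<and> X \<omega> \<in> b} \<omega>) \<partial>M)"
      by (subst *) (auto intro!: nn_integral_cong simp: indicator_def)
    also have "\<dots> = (\<Sum>k. of_nat k * emeasure M {\<omega>\<in>space M. card (U \<omega> \<inter> (W \<inter> a)) = k \<and> X \<omega> \<in> b})"
      by (simp add: nn_integral_suminf nn_integral_cmult)
    also have "\<dots> = (\<Sum>k. of_nat k * emeasure M {\<omega>\<in>space M. card (U \<omega> \<inter> (W \<inter> a)) = k}) * emeasure M {\<omega>\<in>space M. X \<omega> \<in> b}"
      by (simp add: emeasure_eq_measure indep[OF bW b] ennreal_mult mult.assoc flip: ennreal_suminf_multc)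
    also have "(\<Sum>k. of_nat k * emeasure M {\<omega>\<in>space M. card (U \<omega> \<inter> (W \<inter> a)) = k})
        = (\<integral>\<^sup>+\<omega>. of_nat (card (U \<omega> \<inter> (W \<inter> a))) \<partial>M)"
      by (rule nn_integral_of_nat[symmetric]) measurable
    also have "\<dots> = emeasure \<nu> (W \<inter> a)" by (rule mean[OF bW])
    also have "emeasure \<nu> (W \<inter> a) * emeasure M {\<omega>\<in>space M. X \<omega> \<in> b}
        = (\<integral>\<^sup>+x. indicator (W \<inter> a) x * emeasure M {\<omega>\<in>space M. X \<omega> \<in> b} \<partial>\<nu>)"
      using bW sets_nu by (simp add: nn_integral_multc)
    also have "\<dots> = rhs (a \<times> b)"
    proof -
      have "(\<integral>\<^sup>+\<omega>. indicator (a \<times> b) (x, X \<omega>) \<partial>M) = indicator a x * emeasure M {\<omega>\<in>space M. X \<omega> \<in> b}" for x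
      proof -
        have "(\<integral>\<^sup>+\<omega>. indicator (a \<times> b) (x, X \<omega>) \<partial>M) = (\<integral>\<^sup>+\<omega>. indicator a x * indicator {\<omega>\<in>space M. X \<omega> \<in> b} \<omega> \<partial>M)"
          by (intro nn_integral_cong) (auto simp: indicator_def)
        then show ?thesis by (simp add: nn_integral_cmult)
      qed
      then show ?thesis unfolding rhs_def
        by (auto intro!: nn_integral_cong simp: indicator_def)
    qed
    finally show ?thesis .
  qed
  have "Int_stable G" "G \<subseteq> Pow (UNIV \<times> space N)"
    using sets.space_closed by (auto simp: G_def Int_stable_pair_measure_generator)
  then have "lhs D = rhs D" using D'
  proof (induct rule: sigma_sets_induct_disjoint)
    case (basic D)
    then show ?case using rect by (auto simp: G_def)
  next
    case empty
    then show ?case by (simp add: lhs_def rhs_def)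
  next
    case (compl A)
    have A[measurable]: "A \<in> sets (borel \<Otimes>\<^sub>M N)" using compl G_eq by simp
    have A'[measurable]: "UNIV \<times> space N - A \<in> sets (borel \<Otimes>\<^sub>M N)"
      using compl G_eq by (metis sigma_sets.Compl)
    have XN: "X \<omega> \<in> space N" if "\<omega> \<in> space M" for \<omega>
      using measurable_space[OF X that] .
    have split: "indicator (UNIV \<times> space N) (x, X \<omega>) = (indicator (UNIV \<times> space N - A) (x, X \<omega>) + indicator A (x, X \<omega>) :: ennreal)"
      if "\<omega> \<in> space M" for x \<omega>
      using XN[OF that] by (simp add: indicator_def)
    have L: "lhs (UNIV \<times> space N) = lhs (UNIV \<times> space N - A) + lhs A"
    proof -
      have "(\<integral>\<^sup>+x. indicator (UNIV \<times> space N) (x, X \<omega>) \<partial>count_space (U \<omega> \<inter> W))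
          = (\<integral>\<^sup>+x. indicator (UNIV \<times> space N - A) (x, X \<omega>) \<partial>count_space (U \<omega> \<inter> W))
            + (\<integral>\<^sup>+x. indicator A (x, X \<omega>) \<partial>count_space (U \<omega> \<inter> W))" if "\<omega> \<in> space M" for \<omega>
        unfolding split[OF that] by (rule nn_integral_add) auto
      then have "lhs (UNIV \<times> space N) = (\<integral>\<^sup>+\<omega>. (\<integral>\<^sup>+x. indicator (UNIV \<times> space N - A) (x, X \<omega>) \<partial>count_space (U \<omega> \<inter> W))
            + (\<integral>\<^sup>+x. indicator A (x, X \<omega>) \<partial>count_space (U \<omega> \<inter> W)) \<partial>M)"
        unfolding lhs_def by (rule nn_integral_cong)
      also have "\<dots> = lhs (UNIV \<times> space N - A) + lhs A"
        unfolding lhs_def by (rule nn_integral_add) auto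
      finally show ?thesis .
    qed
    have R: "rhs (UNIV \<times> space N) = rhs (UNIV \<times> space N - A) + rhs A"
    proof -
      have "(\<integral>\<^sup>+\<omega>. indicator (UNIV \<times> space N) (x, X \<omega>) \<partial>M)
          = (\<integral>\<^sup>+\<omega>. indicator (UNIV \<times> space N - A) (x, X \<omega>) \<partial>M) + (\<integral>\<^sup>+\<omega>. indicator A (x, X \<omega>) \<partial>M)" for x
      proof -
        have "(\<integral>\<^sup>+\<omega>. indicator (UNIV \<times> space N) (x, X \<omega>) \<partial>M)
            = (\<integral>\<^sup>+\<omega>. indicator (UNIV \<times> space N - A) (x, X \<omega>) + indicator A (x, X \<omega>) \<partial>M)"
          by (intro nn_integral_cong split)
        also have "\<dots> = (\<integral>\<^sup>+\<omega>. indicator (UNIV \<times> space N - A) (x, X \<omega>) \<partial>M) + (\<integral>\<^sup>+\<omega>. indicator A (x, X \<omega>) \<partial>M)"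
          by (rule nn_integral_add) auto
        finally show ?thesis .
      qed
      then have "rhs (UNIV \<times> space N) = (\<integral>\<^sup>+x. indicator W x * (\<integral>\<^sup>+\<omega>. indicator (UNIV \<times> space N - A) (x, X \<omega>) \<partial>M)
            + indicator W x * (\<integral>\<^sup>+\<omega>. indicator A (x, X \<omega>) \<partial>M) \<partial>\<nu>)"
        unfolding rhs_def by (simp add: distrib_left)
      also have "\<dots> = rhs (UNIV \<times> space N - A) + rhs A"
        unfolding rhs_def by (rule nn_integral_add) auto
      finally show ?thesis .
    qed
    \<comment> \<open>The total mass is finite by \<open>fin\<close>; this permits cancelling the
      part of \<open>A\<close> to reach its complement.\<close>
    have "rhs (UNIV \<times> space N) = emeasure \<nu> W"
      using W sets_nu by (auto simp: rhs_def indicator_times XN emeasure_space_1 cong: nn_integral_cong)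
    then have "rhs (UNIV \<times> space N) < \<infinity>" using fin[OF W] by simp
    then have "rhs A \<noteq> \<top>" using R by auto
    moreover have "lhs (UNIV \<times> space N) = rhs (UNIV \<times> space N)"
      by (rule rect) auto
    ultimately show ?case using L R compl(2) by (metis ennreal_add_diff_cancel_right)
  next
    case (union A)
    have A[measurable]: "A i \<in> sets (borel \<Otimes>\<^sub>M N)" for i using union G_eq by auto
    have ind: "indicator (\<Union>i. A i) z = (\<Sum>i. indicator (A i) z :: ennreal)" for z
      using union(1) by (simp add: suminf_indicator)
    have "lhs (\<Union>i. A i) = (\<Sum>i. lhs (A i))"
      unfolding lhs_def by (simp add: ind nn_integral_suminf)
    moreover have "rhs (\<Union>i. A i) = (\<Sum>i. rhs (A i))"
      unfolding rhs_def by (simp add: ind nn_integral_suminf flip: ennreal_suminf_cmult)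
    ultimately show ?case using union by simp
  qed
  then show ?thesis by (simp add: lhs_def rhs_def)
qed

text \<open>Since \<open>X\<close> is independent of \<open>U\<close>, a point at \<open>x\<close>
  carries no information about \<open>X\<close>, so the inner expectation on the right is
  unconditional. The formula passes from windows to the whole space and from indicators to functions
  by monotone limits.\<close>

theorem campbell:
  fixes f :: "'a \<times> 'b \<Rightarrow> ennreal"
  assumes f: "f \<in> borel_measurable (borel \<Otimes>\<^sub>M N)"
  shows "(\<integral>\<^sup>+\<omega>. \<integral>\<^sup>+x. f (x, X \<omega>) \<partial>count_space (U \<omega>) \<partial>M) = (\<integral>\<^sup>+x. \<integral>\<^sup>+\<omega>. f (x, X \<omega>) \<partial>M \<partial>\<nu>)"
proof -
  note [measurable] = X
  have [measurable_cong]: "sets \<nu> = sets borel" by (rule sets_nu)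
  have [measurable]: "ball (0::'a) r \<in> sets borel" for r by simp
  have meas[measurable]: "(\<lambda>\<omega>. \<integral>\<^sup>+x. f (x, X \<omega>) \<partial>count_space (U \<omega>)) \<in> borel_measurable M"
    if [measurable]: "f \<in> borel_measurable (borel \<Otimes>\<^sub>M N)" for f :: "'a \<times> 'b \<Rightarrow> ennreal"
  proof -
    have "(\<lambda>(x, \<omega>). f (x, X \<omega>)) \<in> borel_measurable (borel \<Otimes>\<^sub>M M)"
      by measurable
    from sum_points_measurable[OF U this] show ?thesis by simp
  qed
  show ?thesis
    using f
  proof induction
    case (cong f g)
    have XN: "X \<omega> \<in> space N" if "\<omega> \<in> space M" for \<omega>
      using measurable_space[OF X that] .
    have "(\<integral>\<^sup>+\<omega>. \<integral>\<^sup>+x. f (x, X \<omega>) \<partial>count_space (U \<omega>) \<partial>M) = (\<integral>\<^sup>+\<omega>. \<integral>\<^sup>+x. g (x, X \<omega>) \<partial>count_space (U \<omega>) \<partial>M)"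
      by (intro nn_integral_cong cong) (auto simp: space_pair_measure XN)
    moreover have "(\<integral>\<^sup>+x. \<integral>\<^sup>+\<omega>. f (x, X \<omega>) \<partial>M \<partial>\<nu>) = (\<integral>\<^sup>+x. \<integral>\<^sup>+\<omega>. g (x, X \<omega>) \<partial>M \<partial>\<nu>)"
      by (intro nn_integral_cong cong) (auto simp: space_pair_measure XN)
    ultimately show ?case using cong by simp
  next
    case (set D)
    note [measurable] = set
    let ?T = "\<lambda>(n::nat) \<omega>. \<integral>\<^sup>+x. indicator D (x, X \<omega>) \<partial>count_space (U \<omega> \<inter> ball 0 n)"
    have T: "?T n \<in> borel_measurable M" for n
    proof -
      have "(\<lambda>z. indicator D z * indicator (ball 0 (real n)) (fst z) :: ennreal) \<in> borel_measurable (borel \<Otimes>\<^sub>M N)"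
        by measurable
      from meas[OF this] show ?thesis by (simp add: nn_integral_count_space_restrict)
    qed
    have "(\<integral>\<^sup>+\<omega>. \<integral>\<^sup>+x. indicator D (x, X \<omega>) \<partial>count_space (U \<omega>) \<partial>M) = (\<integral>\<^sup>+\<omega>. (SUP n. ?T n \<omega>) \<partial>M)"
      by (subst nn_integral_count_space_exhaust) simp
    also have "\<dots> = (SUP n. \<integral>\<^sup>+\<omega>. ?T n \<omega> \<partial>M)"
      by (intro nn_integral_monotone_convergence_SUP T)
         (auto simp: incseq_def le_fun_def nn_integral_count_space_restrict indicator_def intro!: nn_integral_mono)
    also have "\<dots> = (SUP n::nat. \<integral>\<^sup>+x. indicator (ball 0 n) x * (\<integral>\<^sup>+\<omega>. indicator D (x, X \<omega>) \<partial>M) \<partial>\<nu>)"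
      by (subst campbell_window_sets) (auto intro: set)
    also have "\<dots> = (\<integral>\<^sup>+x. (SUP n::nat. indicator (ball 0 n) x * (\<integral>\<^sup>+\<omega>. indicator D (x, X \<omega>) \<partial>M)) \<partial>\<nu>)"
      by (intro nn_integral_monotone_convergence_SUP[symmetric])
         (measurable, auto simp: incseq_def le_fun_def indicator_def)
    also have "(\<lambda>x. SUP n::nat. indicator (ball 0 n) x * (\<integral>\<^sup>+\<omega>. indicator D (x, X \<omega>) \<partial>M)) = (\<lambda>x. \<integral>\<^sup>+\<omega>. indicator D (x, X \<omega>) \<partial>M)"
      by (simp add: SUP_mult_right_ennreal[symmetric] SUP_indicator_ball)
    finally show ?case .
  next
    case (mult u c)
    then have [measurable]: "u \<in> borel_measurable (borel \<Otimes>\<^sub>M N)" by simp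
    have "(\<lambda>x. \<integral>\<^sup>+\<omega>. u (x, X \<omega>) \<partial>M) \<in> borel_measurable borel" by measurable
    with mult show ?case by (simp add: nn_integral_cmult)
  next
    case (add u v)
    then have [measurable]: "u \<in> borel_measurable (borel \<Otimes>\<^sub>M N)" "v \<in> borel_measurable (borel \<Otimes>\<^sub>M N)" by simp_all
    have "(\<lambda>x. \<integral>\<^sup>+\<omega>. u (x, X \<omega>) \<partial>M) \<in> borel_measurable borel"
      "(\<lambda>x. \<integral>\<^sup>+\<omega>. v (x, X \<omega>) \<partial>M) \<in> borel_measurable borel" by measurable
    with add show ?case by (simp add: nn_integral_add)
  next
    case (seq F)
    have [measurable]: "F i \<in> borel_measurable (borel \<Otimes>\<^sub>M N)" for i by (rule seq)
    have mono: "i \<le> j \<Longrightarrow> F i z \<le> F j z" for i j z using \<open>incseq F\<close> by (metis incseq_def le_funD)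
    have "(\<integral>\<^sup>+\<omega>. \<integral>\<^sup>+x. (SUP i. F i) (x, X \<omega>) \<partial>count_space (U \<omega>) \<partial>M)
        = (\<integral>\<^sup>+\<omega>. (SUP i. \<integral>\<^sup>+x. F i (x, X \<omega>) \<partial>count_space (U \<omega>)) \<partial>M)"
      unfolding SUP_apply
      by (subst nn_integral_monotone_convergence_SUP) (auto simp: incseq_def le_fun_def mono)
    also have "\<dots> = (SUP i. \<integral>\<^sup>+\<omega>. \<integral>\<^sup>+x. F i (x, X \<omega>) \<partial>count_space (U \<omega>) \<partial>M)"
      by (intro nn_integral_monotone_convergence_SUP meas)
         (auto simp: incseq_def le_fun_def intro!: nn_integral_mono mono)
    also have "\<dots> = (SUP i. \<integral>\<^sup>+x. \<integral>\<^sup>+\<omega>. F i (x, X \<omega>) \<partial>M \<partial>\<nu>)"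
      using seq by simp
    also have "\<dots> = (\<integral>\<^sup>+x. (SUP i. \<integral>\<^sup>+\<omega>. F i (x, X \<omega>) \<partial>M) \<partial>\<nu>)"
      by (intro nn_integral_monotone_convergence_SUP[symmetric])
         (measurable, auto simp: incseq_def le_fun_def intro!: nn_integral_mono mono)
    also have "\<dots> = (\<integral>\<^sup>+x. \<integral>\<^sup>+\<omega>. (SUP i. F i) (x, X \<omega>) \<partial>M \<partial>\<nu>)"
      unfolding SUP_apply
      by (subst nn_integral_monotone_convergence_SUP) (auto simp: incseq_def le_fun_def mono)
    finally show ?case .
  qed
qed

end

text \<open>A quantifier over the points of a random set is no countable union of events, but it
  says that the sum of the indicators over the points is nonzero, and that sum is
  measurable.\<close>

lemma bex_points_measurable:
  assumes U: "point_process M U" and P: "Measurable.pred (borel \<Otimes>\<^sub>M M) (\<lambda>(x, \<omega>). P x \<omega>)"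
  shows "Measurable.pred M (\<lambda>\<omega>. \<exists>x\<in>U \<omega>. P x \<omega>)"
proof -
  have [measurable]: "(\<lambda>\<omega>. \<integral>\<^sup>+x. indicator {z. P (fst z) (snd z)} (x, \<omega>) \<partial>count_space (U \<omega>)) \<in> borel_measurable M"
    using P by (intro sum_points_measurable[OF U] borel_measurable_indicator') (simp add: case_prod_beta')
  have "(\<exists>x\<in>U \<omega>. P x \<omega>) \<longleftrightarrow> (\<integral>\<^sup>+x. indicator {z. P (fst z) (snd z)} (x, \<omega>) \<partial>count_space (U \<omega>)) \<noteq> 0" for \<omega>
    by (subst nn_integral_0_iff_AE) (auto simp: AE_count_space indicator_def)
  then show ?thesis by simp
qed

lemma ball_points_measurable:
  assumes U: "point_process M U" and P: "Measurable.pred (borel \<Otimes>\<^sub>M M) (\<lambda>(x, \<omega>). P x \<omega>)"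
  shows "Measurable.pred M (\<lambda>\<omega>. \<forall>x\<in>U \<omega>. P x \<omega>)"
proof -
  have "Measurable.pred (borel \<Otimes>\<^sub>M M) (\<lambda>(x, \<omega>). \<not> P x \<omega>)" using P by simp
  from bex_points_measurable[OF U this] have "Measurable.pred M (\<lambda>\<omega>. \<not> (\<exists>x\<in>U \<omega>. \<not> P x \<omega>))"
    by measurable
  then show ?thesis by simp
qed

section \<open>Laws of Poisson processes\<close>

lemma suminf_poisson_prob_mean:
  assumes "0 \<le> r"
  shows "(\<Sum>k. of_nat k * ennreal (poisson_prob r k)) = ennreal r"
proof -
  have "(\<lambda>k. r * exp (- r) * (r ^ k /\<^sub>R fact k)) sums (r * exp (- r) * exp r)"
    by (intro sums_mult exp_converges)
  also have "(\<lambda>k. r * exp (- r) * (r ^ k /\<^sub>R fact k)) = (\<lambda>k. real (Suc k) * poisson_prob r (Suc k))"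
    by (auto simp: poisson_prob_def field_simps fun_eq_iff simp del: of_nat_Suc)
  also have "r * exp (- r) * exp r = r" by (simp add: exp_minus)
  \<comment> \<open>The term for \<open>k = 0\<close> vanishes, so the shifted series has the same
    sum as the full one.\<close>
  finally have "(\<lambda>k. real k * poisson_prob r k) sums r"
    by (subst (asm) sums_Suc_iff) simp
  moreover have "0 \<le> poisson_prob r k" for k
    using assms by (simp add: poisson_prob_def)
  ultimately have "(\<Sum>k. ennreal (real k * poisson_prob r k)) = ennreal r"
    by (intro suminf_ennreal_eq) auto
  then show ?thesis
    using \<open>\<And>k. 0 \<le> poisson_prob r k\<close> by (simp add: ennreal_mult ennreal_of_nat_eq_real_of_nat)
qed

lemma poisson_pp_prob_card:
  assumes "poisson_pp M \<Phi> mu" "A \<in> sets borel" "bounded A"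
  shows "measure M {\<omega> \<in> space M. card (\<Phi> \<omega> \<inter> A) = k} = poisson_prob (mu A) k"
  using assms(1)[unfolded poisson_pp_def, THEN conjunct2, rule_format, of 1 "\<lambda>_. A" "\<lambda>_. k"] assms(2,3)
  by (simp add: disjoint_family_on_def)

lemma poisson_pp_mean:
  assumes "prob_space M" "poisson_pp M \<Phi> mu" "A \<in> sets borel" "bounded A" "0 \<le> mu A"
  shows "(\<integral>\<^sup>+\<omega>. of_nat (card (\<Phi> \<omega> \<inter> A)) \<partial>M) = ennreal (mu A)"
proof -
  interpret prob_space M by fact
  have "(\<lambda>\<omega>. card (\<Phi> \<omega> \<inter> A)) \<in> measurable M (count_space UNIV)"
    using assms by (intro point_process_card_measurable) (auto simp: poisson_pp_def)
  then show ?thesis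
    using assms by (simp add: nn_integral_of_nat emeasure_eq_measure poisson_pp_prob_card suminf_poisson_prob_mean)
qed

text \<open>Count events allow several, possibly overlapping, windows, so concatenating the two
  lists of windows stays inside the family.\<close>

lemma Int_stable_count_events: "Int_stable (count_events M \<Phi>)"
proof (rule Int_stableI)
  fix a b assume "a \<in> count_events M \<Phi>" "b \<in> count_events M \<Phi>"
  then obtain n :: nat and A k and n' :: nat and A' k' where
    a: "a = {\<omega> \<in> space M. \<forall>i<n. card (\<Phi> \<omega> \<inter> A i) = k i}" "\<forall>i<n. A i \<in> sets borel \<and> bounded (A i)" and
    b: "b = {\<omega> \<in> space M. \<forall>i<n'. card (\<Phi> \<omega> \<inter> A' i) = k' i}" "\<forall>i<n'. A' i \<in> sets borel \<and> bounded (A' i)"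
    unfolding count_events_def mem_Collect_eq by (elim exE conjE) blast
  define A'' where "A'' i = (if i < n then A i else A' (i - n))" for i
  define k'' where "k'' i = (if i < n then k i else k' (i - n))" for i
  have split: "(\<forall>i<n + n'. P i) \<longleftrightarrow> (\<forall>i<n. P i) \<and> (\<forall>i<n'. P (n + i))" for P :: "nat \<Rightarrow> bool"
    by (metis add_diff_inverse_nat nat_add_left_cancel_less trans_less_add1)
  have "a \<inter> b = {\<omega> \<in> space M. \<forall>i<n + n'. card (\<Phi> \<omega> \<inter> A'' i) = k'' i}"
    unfolding split by (auto simp: a b A''_def k''_def)
  moreover have "\<forall>i<n + n'. A'' i \<in> sets borel \<and> bounded (A'' i)"
    unfolding split using a b by (auto simp: A''_def)
  ultimately show "a \<inter> b \<in> count_events M \<Phi>"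
    unfolding count_events_def by blast
qed

lemma count_eventsI:
  assumes "A \<in> sets borel" "bounded A"
  shows "{\<omega> \<in> space M. card (\<Phi> \<omega> \<inter> A) = k} \<in> count_events M \<Phi>"
  unfolding count_events_def using assms
  by (intro CollectI exI[of _ "1::nat"] exI[of _ "\<lambda>_. A"] exI[of _ "\<lambda>_. k"]) auto

lemma count_events_sets:
  assumes "point_process M \<Phi>"
  shows "count_events M \<Phi> \<subseteq> sets M"
proof
  fix a assume "a \<in> count_events M \<Phi>"
  then obtain n :: nat and A k where
    a: "a = {\<omega> \<in> space M. \<forall>i\<in>{..<n}. card (\<Phi> \<omega> \<inter> A i) = k i}" "\<forall>i<n. A i \<in> sets borel \<and> bounded (A i)"
    by (auto simp: count_events_def)
  then show "a \<in> sets M"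
    using assms unfolding a(1) by (intro sets.sets_Collect_finite_All) (auto simp: point_process_def)
qed

text \<open>Replaces the generator of single counts by one that is closed under intersection, as
  needed to identify a law from its values on generators.\<close>

lemma sets_conf: "sets conf = sigma_sets (Collect locally_finite) (count_events conf (\<lambda>\<phi>. \<phi>))"
proof
  have "{{\<phi>. locally_finite \<phi> \<and> card (\<phi> \<inter> A) = k} | A k. A \<in> sets borel \<and> bounded A}
      \<subseteq> sigma_sets (Collect locally_finite) (count_events conf (\<lambda>\<phi>::'a set. \<phi>))"
    using count_eventsI[where M=conf and \<Phi>="\<lambda>\<phi>. \<phi>"]
    by (auto simp: space_conf intro!: sigma_sets.Basic)
  then show "sets (conf :: 'a set measure) \<subseteq> sigma_sets (Collect locally_finite) (count_events conf (\<lambda>\<phi>. \<phi>))"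
    unfolding conf_def by (subst sets_measure_of) (auto intro!: sigma_sets_mono)
  show "sigma_sets (Collect locally_finite) (count_events conf (\<lambda>\<phi>. \<phi>)) \<subseteq> sets (conf :: 'a set measure)"
    using count_events_sets[OF point_process_conf]
    by (metis sets.sigma_sets_subset space_conf)
qed

lemma count_window_sets_conf:
  fixes m :: nat
  assumes "\<And>j. j < m \<Longrightarrow> C j \<in> sets borel \<and> bounded (C j)"
  shows "{\<phi>. locally_finite \<phi> \<and> (\<forall>j<m. card (\<phi> \<inter> C j) = \<kappa> j)} \<in> sets conf"
proof -
  have "{\<phi>. locally_finite \<phi> \<and> (\<forall>j<m. card (\<phi> \<inter> C j) = \<kappa> j)} \<in> count_events conf (\<lambda>\<phi>. \<phi>)"
    unfolding count_events_def space_conf mem_Collect_eq using assms by blast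
  then show ?thesis
    using count_events_sets[OF point_process_conf] by blast
qed

text \<open>\<Phi> is still a point process when \<Omega> carries only the sigma-algebra of the
  count events of \<Phi>, so it is measurable from that coarser space. This turns independence of
  count events into independence of configurations.\<close>

lemma vimage_conf_sigma_count_events:
  assumes "point_process M \<Phi>" "E \<in> sets conf"
  shows "\<Phi> -` E \<inter> space M \<in> sigma_sets (space M) (count_events M \<Phi>)"
proof -
  let ?S = "sigma (space M) (count_events M \<Phi>)"
  have sub: "count_events M \<Phi> \<subseteq> Pow (space M)"
    by (auto simp: count_events_def)
  have "point_process ?S \<Phi>"
    using assms(1) count_eventsI[of _ M \<Phi>] sub
    by (auto simp: point_process_def space_measure_of_conv)
  then have "\<Phi> -` E \<inter> space ?S \<in> sets ?S"
    using assms(2) unfolding point_process_iff by (rule measurable_sets)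
  then show ?thesis using sub by (simp add: space_measure_of_conv)
qed

text \<open>The atoms are indexed by nonempty sets \<open>S\<close> of indices: \<open>D S\<close>
  consists of the points that lie in \<open>A i\<close> exactly for the \<open>i\<close> in
  \<open>S\<close>. The empty \<open>S\<close> is left out because its atom, the complement of all
  the windows, is unbounded.\<close>

lemma finite_family_atoms:
  fixes A :: "nat \<Rightarrow> 'a::euclidean_space set"
  assumes "\<forall>i<n. A i \<in> sets borel \<and> bounded (A i)"
  shows "\<exists>(m::nat) C J. (\<forall>j<m. C j \<in> sets borel \<and> bounded (C j)) \<and> disjoint_family_on C {..<m} \<and>
    (\<forall>i<n. J i \<subseteq> {..<m} \<and> A i = (\<Union>j\<in>J i. C j))"
proof -
  let ?P = "Pow {..<n} - {{}}"
  obtain h where h: "bij_betw h {0..<card ?P} ?P"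
    using ex_bij_betw_nat_finite[of ?P] by auto
  define D where "D S = (\<Inter>i\<in>S. A i) - (\<Union>i\<in>{..<n} - S. A i)" for S
  have hP: "h j \<subseteq> {..<n}" "h j \<noteq> {}" if "j < card ?P" for j
    using bij_betwE[OF h] that by auto
  have "(\<forall>j<card ?P. D (h j) \<in> sets borel \<and> bounded (D (h j)))"
  proof (intro allI impI)
    fix j assume j: "j < card ?P"
    from hP(2)[OF j] obtain i where i: "i \<in> h j" by (meson ex_in_conv)
    with hP(1)[OF j] have "i < n" by (metis lessThan_iff subsetD)
    have "finite (h j)" by (rule finite_subset[OF hP(1)[OF j]]) simp
    then have "D (h j) \<in> sets borel"
      unfolding D_def using hP[OF j] assms by (intro sets.Diff sets.finite_INT sets.finite_UN) auto
    moreover have "D (h j) \<subseteq> A i" using i by (auto simp: D_def)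
    ultimately show "D (h j) \<in> sets borel \<and> bounded (D (h j))"
      using assms \<open>i < n\<close> by (auto intro: bounded_subset)
  qed
  moreover have "disjoint_family_on (\<lambda>j. D (h j)) {..<card ?P}"
    unfolding disjoint_family_on_def
  proof (intro ballI impI)
    fix j j' assume "j \<in> {..<card ?P}" "j' \<in> {..<card ?P}" "j \<noteq> j'"
    then have j: "j < card ?P" "j' < card ?P" and "j \<noteq> j'" by simp_all
    have "h j \<noteq> h j'"
      using inj_onD[OF bij_betw_imp_inj_on[OF h], of j j'] j \<open>j \<noteq> j'\<close>
      by (metis atLeastLessThan_iff le0)
    from \<open>h j \<noteq> h j'\<close> obtain i where i: "i \<in> h j \<and> i \<notin> h j' \<or> i \<in> h j' \<and> i \<notin> h j"
      by (auto simp: set_eq_iff)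
    then have "i \<in> {..<n}" using hP(1)[OF j(1)] hP(1)[OF j(2)] by (meson subsetD)
    with i show "D (h j) \<inter> D (h j') = {}" by (auto simp: D_def)
  qed
  moreover have "\<forall>i<n. {j. j < card ?P \<and> i \<in> h j} \<subseteq> {..<card ?P} \<and> A i = (\<Union>j\<in>{j. j < card ?P \<and> i \<in> h j}. D (h j))"
  proof (intro allI impI)
    fix i assume i: "i < n"
    have sub: "A i \<subseteq> (\<Union>j\<in>{j. j < card ?P \<and> i \<in> h j}. D (h j))"
    proof
      fix x assume x: "x \<in> A i"
      let ?S = "{i'. i' < n \<and> x \<in> A i'}"
      have "?S \<in> ?P" using x i by auto
      then have "?S \<in> h ` {0..<card ?P}"
        unfolding bij_betw_imp_surj_on[OF h] .
      then obtain j where j: "j \<in> {0..<card ?P}" "?S = h j" by (rule imageE)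
      then have "j < card ?P" "h j = ?S" by simp_all
      moreover have "x \<in> D ?S" by (auto simp: D_def)
      ultimately show "x \<in> (\<Union>j\<in>{j. j < card ?P \<and> i \<in> h j}. D (h j))"
        using x i by (intro UN_I[of j]) simp_all
    qed
    have "D (h j) \<subseteq> A i" if "i \<in> h j" for j
      using that by (auto simp: D_def)
    then have "(\<Union>j\<in>{j. j < card ?P \<and> i \<in> h j}. D (h j)) \<subseteq> A i"
      by blast
    with sub have "A i = (\<Union>j\<in>{j. j < card ?P \<and> i \<in> h j}. D (h j))"
      by (rule equalityI)
    moreover have "{j. j < card ?P \<and> i \<in> h j} \<subseteq> {..<card ?P}"
      by (rule subsetI) simp
    ultimately show "{j. j < card ?P \<and> i \<in> h j} \<subseteq> {..<card ?P} \<and> A i = (\<Union>j\<in>{j. j < card ?P \<and> i \<in> h j}. D (h j))"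
      by (rule conjI[rotated])
  qed
  ultimately show ?thesis
    by - (rule exI[of _ "card ?P"], rule exI[of _ "\<lambda>j. D (h j)"],
      rule exI[of _ "\<lambda>i. {j. j < card ?P \<and> i \<in> h j}"], intro conjI)
qed

text \<open>The value depends on \<open>mu\<close> alone and not on the underlying probability
  space, which is what makes two processes with the same \<open>mu\<close> comparable.\<close>

lemma poisson_pp_emeasure_disjoint:
  fixes \<Phi> :: "'w \<Rightarrow> 'a::euclidean_space set" and m :: nat
  assumes "prob_space M" and P: "poisson_pp M \<Phi> mu"
    and C: "\<And>j. j < m \<Longrightarrow> C j \<in> sets borel \<and> bounded (C j)" and dC: "disjoint_family_on C {..<m}"
  shows "emeasure (distr M conf \<Phi>) {\<phi>. locally_finite \<phi> \<and> (\<forall>j<m. card (\<phi> \<inter> C j) = \<kappa> j)} =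
    ennreal (\<Prod>j<m. poisson_prob (mu (C j)) (\<kappa> j))"
proof -
  interpret prob_space M by fact
  have m: "\<Phi> \<in> measurable M conf" using P by (auto simp: poisson_pp_def point_process_iff)
  have "{\<phi>. locally_finite \<phi> \<and> (\<forall>j<m. card (\<phi> \<inter> C j) = \<kappa> j)} \<in> sets conf"
    using C by (rule count_window_sets_conf)
  then have "emeasure (distr M conf \<Phi>) {\<phi>. locally_finite \<phi> \<and> (\<forall>j<m. card (\<phi> \<inter> C j) = \<kappa> j)}
      = emeasure M {\<omega> \<in> space M. \<forall>j<m. card (\<Phi> \<omega> \<inter> C j) = \<kappa> j}"
    using measurable_space[OF m]
    by (subst emeasure_distr[OF m]) (auto intro!: arg_cong[where f="emeasure M"] simp: space_conf)
  moreover have "prob {\<omega> \<in> space M. \<forall>j<m. card (\<Phi> \<omega> \<inter> C j) = \<kappa> j} = (\<Prod>j<m. poisson_prob (mu (C j)) (\<kappa> j))"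
    using P[unfolded poisson_pp_def, THEN conjunct2, rule_format, of m C \<kappa>] C dC by simp
  ultimately show ?thesis
    by (simp add: emeasure_eq_measure)
qed

text \<open>The Poisson hypothesis only speaks about disjoint windows; overlapping windows are reduced to
  the atoms of the algebra they generate.\<close>

lemma poisson_pp_distr_eq:
  fixes \<Phi> :: "'w \<Rightarrow> 'a::euclidean_space set" and \<Phi>' :: "'v \<Rightarrow> 'a set"
  assumes "prob_space M" "prob_space M'" and P: "poisson_pp M \<Phi> mu" "poisson_pp M' \<Phi>' mu"
  shows "distr M conf \<Phi> = distr M' conf \<Phi>'"
proof -
  interpret M: prob_space M by fact
  interpret M': prob_space M' by fact
  have pp: "point_process M \<Phi>" "point_process M' \<Phi>'"
    using P by (auto simp: poisson_pp_def)
  then have m[measurable]: "\<Phi> \<in> measurable M conf" "\<Phi>' \<in> measurable M' conf"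
    by (auto simp: point_process_iff)
  let ?G = "count_events conf (\<lambda>\<phi>. \<phi>) :: 'a set set set"
  show ?thesis
  proof (rule measure_eqI_generator_eq[where E="?G" and \<Omega>="Collect locally_finite" and A="\<lambda>_. Collect locally_finite"])
    show "Int_stable ?G" by (rule Int_stable_count_events)
    show "?G \<subseteq> Pow (Collect locally_finite)" by (auto simp: count_events_def space_conf)
    show "sets (distr M conf \<Phi>) = sigma_sets (Collect locally_finite) ?G"
      "sets (distr M' conf \<Phi>') = sigma_sets (Collect locally_finite) ?G"
      by (simp_all add: sets_conf)
    have "Collect locally_finite \<in> ?G"
      unfolding count_events_def by (intro CollectI exI[of _ "0::nat"]) (auto simp: space_conf)
    then show "range (\<lambda>_::nat. Collect locally_finite) \<subseteq> ?G" by auto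
    show "emeasure (distr M conf \<Phi>) (Collect locally_finite) \<noteq> \<infinity>"
      by (simp add: M.emeasure_eq_measure emeasure_distr flip: space_conf)
    fix X assume "X \<in> ?G"
    then obtain n :: nat and A k where X: "X = {\<phi>. locally_finite \<phi> \<and> (\<forall>i<n. card (\<phi> \<inter> A i) = k i)}"
      and A: "\<forall>i<n. A i \<in> sets borel \<and> bounded (A i)"
      unfolding count_events_def space_conf mem_Collect_eq by blast
    from finite_family_atoms[of n A, OF A]
    obtain m :: nat and C J where "\<forall>j<m. C j \<in> sets borel \<and> bounded (C j)"
      and dC: "disjoint_family_on C {..<m}" and "\<forall>i<n. J i \<subseteq> {..<m} \<and> A i = (\<Union>j\<in>J i. C j)"
      by (elim exE conjE) (rule that)
    then have C: "\<And>j. j < m \<Longrightarrow> C j \<in> sets borel \<and> bounded (C j)"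
      and J: "\<And>i. i < n \<Longrightarrow> J i \<subseteq> {..<m} \<and> A i = (\<Union>j\<in>J i. C j)"
      by blast+
    \<comment> \<open>The vectors of atom counts that are compatible with the prescribed window
      counts. They are extensional, so two different vectors differ at some atom and their events
      are disjoint; there are countably many of them.\<close>
    define K where "K = {\<kappa> \<in> {..<m} \<rightarrow>\<^sub>E UNIV. \<forall>i<n. (\<Sum>j\<in>J i. \<kappa> j) = (k i :: nat)}"
    define Y where "Y \<kappa> = {\<phi>::'a set. locally_finite \<phi> \<and> (\<forall>j<m. card (\<phi> \<inter> C j) = \<kappa> j)}" for \<kappa>
    have "countable K"
      unfolding K_def by (rule countable_subset[OF _ countable_PiE[of "{..<m}" "\<lambda>_. UNIV"]]) auto
    have Y: "Y \<kappa> \<in> sets conf" for \<kappa>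
      unfolding Y_def using C by (rule count_window_sets_conf)
    have dY: "disjoint_family_on Y K"
      unfolding disjoint_family_on_def
    proof (intro ballI impI)
      fix \<kappa> \<kappa>' assume \<kappa>: "\<kappa> \<in> K" "\<kappa>' \<in> K" "\<kappa> \<noteq> \<kappa>'"
      then obtain j where "j < m" "\<kappa> j \<noteq> \<kappa>' j"
        unfolding K_def by (metis (no_types, lifting) PiE_ext lessThan_iff mem_Collect_eq)
      then show "Y \<kappa> \<inter> Y \<kappa>' = {}" by (auto simp: Y_def)
    qed
    have card_A: "card (\<phi> \<inter> A i) = (\<Sum>j\<in>J i. card (\<phi> \<inter> C j))" if "i < n" "locally_finite \<phi>" for \<phi> :: "'a set" and i
    proof -
      have "\<phi> \<inter> A i = (\<Union>j\<in>J i. \<phi> \<inter> C j)" using J that by auto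
      also have "card \<dots> = (\<Sum>j\<in>J i. card (\<phi> \<inter> C j))"
      proof (rule card_UN_disjoint)
        have Ji: "J i \<subseteq> {..<m}" using J[OF that(1)] by simp
        then show "finite (J i)" by (rule finite_subset) simp
        show "\<forall>j\<in>J i. finite (\<phi> \<inter> C j)"
          using Ji C that(2) by (auto simp: locally_finite_def)
        show "\<forall>j\<in>J i. \<forall>j'\<in>J i. j \<noteq> j' \<longrightarrow> (\<phi> \<inter> C j) \<inter> (\<phi> \<inter> C j') = {}"
        proof (intro ballI impI)
          fix j j' assume "j \<in> J i" "j' \<in> J i" "j \<noteq> j'"
          then have "C j \<inter> C j' = {}"
            using Ji by (intro disjoint_family_onD[OF dC]) auto
          then show "(\<phi> \<inter> C j) \<inter> (\<phi> \<inter> C j') = {}" by blast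
        qed
      qed
      finally show ?thesis .
    qed
    have X_eq: "X = (\<Union>\<kappa>\<in>K. Y \<kappa>)"
    proof (intro set_eqI iffI)
      fix \<phi> assume "\<phi> \<in> X"
      then have \<phi>: "locally_finite \<phi>" "\<And>i. i < n \<Longrightarrow> card (\<phi> \<inter> A i) = k i" by (auto simp: X)
      let ?\<kappa> = "restrict (\<lambda>j. card (\<phi> \<inter> C j)) {..<m}"
      have "(\<Sum>j\<in>J i. ?\<kappa> j) = k i" if "i < n" for i
        using card_A[OF that \<phi>(1)] \<phi>(2)[OF that] J[OF that] by (simp add: subset_iff cong: sum.cong)
      then have "?\<kappa> \<in> K" by (auto simp: K_def)
      moreover have "\<phi> \<in> Y ?\<kappa>" using \<phi> by (auto simp: Y_def)
      ultimately show "\<phi> \<in> (\<Union>\<kappa>\<in>K. Y \<kappa>)" by blast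
    next
      fix \<phi> assume "\<phi> \<in> (\<Union>\<kappa>\<in>K. Y \<kappa>)"
      then obtain \<kappa> where \<kappa>: "\<kappa> \<in> K" "\<phi> \<in> Y \<kappa>" by auto
      have "card (\<phi> \<inter> A i) = k i" if "i < n" for i
      proof -
        have "card (\<phi> \<inter> A i) = (\<Sum>j\<in>J i. \<kappa> j)"
          using card_A[OF that] \<kappa> J[OF that] by (auto simp: Y_def intro!: sum.cong)
        then show ?thesis using \<kappa> that by (simp add: K_def)
      qed
      then show "\<phi> \<in> X" using \<kappa> by (auto simp: X Y_def)
    qed
    have "emeasure (distr M conf \<Phi>) X = (\<integral>\<^sup>+\<kappa>. emeasure (distr M conf \<Phi>) (Y \<kappa>) \<partial>count_space K)"
      unfolding X_eq using Y dY \<open>countable K\<close> by (intro emeasure_UN_countable) auto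
    also have "\<dots> = (\<integral>\<^sup>+\<kappa>. emeasure (distr M' conf \<Phi>') (Y \<kappa>) \<partial>count_space K)"
      unfolding Y_def by (simp only: poisson_pp_emeasure_disjoint[OF assms(1,3) C dC] poisson_pp_emeasure_disjoint[OF assms(2,4) C dC])
    also have "\<dots> = emeasure (distr M' conf \<Phi>') X"
      unfolding X_eq using Y dY \<open>countable K\<close> by (intro emeasure_UN_countable[symmetric]) auto
    finally show "emeasure (distr M conf \<Phi>) X = emeasure (distr M' conf \<Phi>') X" .
  qed (auto)
qed

section \<open>Invariance of Poisson processes under point reflection\<close>

lemma reflect_image: "(\<lambda>y. z - y) ` A = {x. z - x \<in> A}"
  for z :: "'a::ab_group_add"
proof (intro set_eqI iffI)
  fix x assume "x \<in> {x. z - x \<in> A}"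
  then show "x \<in> (\<lambda>y. z - y) ` A"
    by (intro image_eqI[of _ _ "z - x"]) simp_all
qed auto

lemma reflect_image_Int: "(\<lambda>y. z - y) ` \<phi> \<inter> A = (\<lambda>y. z - y) ` (\<phi> \<inter> (\<lambda>y. z - y) ` A)"
  for z :: "'a::ab_group_add"
  by (simp add: reflect_image set_eq_iff)

lemma measure_lborel_reflect:
  fixes z :: "'a::euclidean_space"
  assumes "A \<in> sets borel"
  shows "(\<lambda>y. z - y) ` A \<in> sets borel" "measure lborel ((\<lambda>y. z - y) ` A) = measure lborel A"
proof -
  have im: "(\<lambda>y. z - y) ` A = (\<lambda>y. z - y) -` A"
    by (simp add: reflect_image vimage_def)
  show "(\<lambda>y. z - y) ` A \<in> sets borel"
    unfolding im using assms by (intro measurable_sets_borel[where M=borel]) auto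
  \<comment> \<open>Affine change of variables with factor -1, whose Jacobian has absolute value 1
    in every dimension.\<close>
  have "lborel = distr lborel borel (\<lambda>y. z - y)"
    using lborel_affine[of "-1" z] by (simp add: density_1)
  then have "measure lborel A = measure (distr lborel borel (\<lambda>y. z - y)) A"
    by simp
  also have "\<dots> = measure lborel ((\<lambda>y. z - y) ` A)"
    using assms by (simp add: measure_distr im)
  finally show "measure lborel ((\<lambda>y. z - y) ` A) = measure lborel A" ..
qed

text \<open>Moves the reflection from the configuration to the window, where the hypotheses on
  counts in fixed windows and the invariance of Lebesgue measure apply.\<close>

lemma card_reflect_Int:
  fixes z :: "'a::euclidean_space"
  shows "card ((\<lambda>y. z - y) ` \<phi> \<inter> A) = card (\<phi> \<inter> (\<lambda>y. z - y) ` A)"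
  by (simp add: reflect_image_Int[of z \<phi>] card_image inj_on_def)

lemma bounded_reflect: "bounded A \<Longrightarrow> bounded ((\<lambda>y. z - y) ` A)"
  for A :: "'a::euclidean_space set"
proof -
  assume "bounded A"
  then obtain b where "\<And>x. x \<in> A \<Longrightarrow> norm x \<le> b" by (auto simp: bounded_iff)
  then have "norm (z - x) \<le> norm z + b" if "x \<in> A" for x
    using norm_triangle_ineq4[of z x] \<open>\<And>x. x \<in> A \<Longrightarrow> norm x \<le> b\<close>[OF that] by linarith
  then show ?thesis
    unfolding bounded_iff by blast
qed

lemma point_process_reflect:
  fixes z :: "'a::euclidean_space"
  assumes "point_process M \<Phi>"
  shows "point_process M (\<lambda>\<omega>. (\<lambda>y. z - y) ` \<Phi> \<omega>)"
proof -
  have "finite ((\<lambda>y. z - y) ` \<phi> \<inter> A)" if "finite (\<phi> \<inter> (\<lambda>y. z - y) ` A)" for \<phi> A :: "'a set"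
    using that by (subst reflect_image_Int) (rule finite_imageI)
  then show ?thesis
    using assms unfolding point_process_def card_reflect_Int
    by (simp add: bounded_reflect measure_lborel_reflect(1))
qed

lemma hom_ppp_reflect:
  assumes "hom_ppp M \<Phi> lam"
  shows "hom_ppp M (\<lambda>\<omega>. (\<lambda>y. z - y) ` \<Phi> \<omega>) lam"
  unfolding hom_ppp_def poisson_pp_def
proof (intro conjI allI impI)
  show "point_process M (\<lambda>\<omega>. (\<lambda>y. z - y) ` \<Phi> \<omega>)"
    using assms by (intro point_process_reflect) (auto simp: hom_ppp_def poisson_pp_def)
  fix n :: nat and A :: "nat \<Rightarrow> point set" and k :: "nat \<Rightarrow> nat"
  assume A: "(\<forall>i<n. A i \<in> sets borel \<and> bounded (A i)) \<and> disjoint_family_on A {..<n}"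
  have "(\<lambda>y. z - y) ` B \<inter> (\<lambda>y. z - y) ` C = (\<lambda>y. z - y) ` (B \<inter> C)" for B C
    by (rule image_Int[symmetric]) (auto simp: inj_on_def)
  then have "disjoint_family_on (\<lambda>i. (\<lambda>y. z - y) ` A i) {..<n}"
    using A by (auto simp: disjoint_family_on_def)
  moreover have "\<forall>i<n. (\<lambda>y. z - y) ` A i \<in> sets borel \<and> bounded ((\<lambda>y. z - y) ` A i)"
    using A by (auto intro: measure_lborel_reflect(1) bounded_reflect)
  ultimately have "measure M {\<omega> \<in> space M. \<forall>i<n. card (\<Phi> \<omega> \<inter> (\<lambda>y. z - y) ` A i) = k i}
      = (\<Prod>i<n. poisson_prob (lam * measure lborel ((\<lambda>y. z - y) ` A i)) (k i))"
    using assms[unfolded hom_ppp_def poisson_pp_def, THEN conjunct2, rule_format,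
        of n "\<lambda>i. (\<lambda>y. z - y) ` A i" k] by simp
  also have "\<dots> = (\<Prod>i<n. poisson_prob (lam * measure lborel (A i)) (k i))"
    using A by (intro prod.cong) (auto simp: measure_lborel_reflect(2))
  finally show "measure M {\<omega> \<in> space M. \<forall>i<n. card ((\<lambda>y. z - y) ` \<Phi> \<omega> \<inter> A i) = k i}
      = (\<Prod>i<n. poisson_prob (lam * measure lborel (A i)) (k i))"
    by (simp add: card_reflect_Int)
qed

lemma reflect_conf_measurable: "(\<lambda>\<phi>. (\<lambda>y. z - y) ` \<phi>) \<in> measurable conf conf"
  using point_process_reflect[OF point_process_conf] by (simp add: point_process_iff)

text \<open>The hetnet cells depend on both processes jointly, so invariance of each law is not
  enough: independence makes the joint law the product of two laws, each invariant under the common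
  reflection.\<close>

lemma (in prob_space) hom_ppp_pair_reflect:
  assumes P: "hom_ppp M \<Phi> lam" "hom_ppp M \<Psi> lam'" and ind: "indep_var conf \<Phi> conf \<Psi>"
  shows "distr M (conf \<Otimes>\<^sub>M conf) (\<lambda>\<omega>. ((\<lambda>y. z - y) ` \<Phi> \<omega>, (\<lambda>y. z - y) ` \<Psi> \<omega>))
       = distr M (conf \<Otimes>\<^sub>M conf) (\<lambda>\<omega>. (\<Phi> \<omega>, \<Psi> \<omega>))"
proof -
  let ?R = "\<lambda>\<phi>. (\<lambda>y. z - y) ` \<phi>"
  have eq: "distr M conf (\<lambda>\<omega>. ?R (\<Phi> \<omega>)) = distr M conf \<Phi>" if "hom_ppp M \<Phi> lam" for \<Phi> lam
    using that hom_ppp_reflect[OF that] prob_space_axioms unfolding hom_ppp_def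
    by (intro poisson_pp_distr_eq[of M M]) auto
  have "indep_var conf (?R \<circ> \<Phi>) conf (?R \<circ> \<Psi>)"
    by (rule indep_var_compose[OF ind reflect_conf_measurable reflect_conf_measurable])
  then have "distr M (conf \<Otimes>\<^sub>M conf) (\<lambda>\<omega>. (?R (\<Phi> \<omega>), ?R (\<Psi> \<omega>)))
      = distr M conf (\<lambda>\<omega>. ?R (\<Phi> \<omega>)) \<Otimes>\<^sub>M distr M conf (\<lambda>\<omega>. ?R (\<Psi> \<omega>))"
    by (subst (asm) indep_var_distribution_eq) (simp add: comp_def)
  also have "\<dots> = distr M conf \<Phi> \<Otimes>\<^sub>M distr M conf \<Psi>"
    by (simp add: eq[OF P(1)] eq[OF P(2)])
  also have "\<dots> = distr M (conf \<Otimes>\<^sub>M conf) (\<lambda>\<omega>. (\<Phi> \<omega>, \<Psi> \<omega>))"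
    using ind by (subst (asm) indep_var_distribution_eq) simp
  finally show ?thesis .
qed

section \<open>Cox processes on Poisson lines\<close>

text \<open>If \<open>sin \<theta> = 0\<close>, the coordinates only change sign. Otherwise the
  rotation is done by two one-dimensional substitutions: \<open>t\<close> is replaced by the first
  coordinate \<open>u = r * c - t * s\<close>, the integrals are exchanged, and \<open>r\<close> is
  replaced by the second coordinate \<open>(r - u * c) / s\<close>. The factors
  \<open>1 / \<bar>s\<bar>\<close> and \<open>\<bar>s\<bar>\<close> cancel.\<close>

lemma nn_integral_rotate:
  fixes f :: "real \<times> real \<Rightarrow> ennreal"
  assumes [measurable]: "f \<in> borel_measurable borel"
  shows "(\<integral>\<^sup>+r. \<integral>\<^sup>+t. f (r * cos \<theta> - t * sin \<theta>, r * sin \<theta> + t * cos \<theta>) \<partial>lborel \<partial>lborel) = (\<integral>\<^sup>+z. f z \<partial>lborel)"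
proof -
  have [measurable]: "f \<in> borel_measurable (lborel \<Otimes>\<^sub>M lborel)"
    using assms by (simp add: lborel_prod)
  have rhs: "(\<integral>\<^sup>+z. f z \<partial>lborel) = (\<integral>\<^sup>+x. \<integral>\<^sup>+y. f (x, y) \<partial>lborel \<partial>lborel)"
    by (subst lborel_prod[symmetric], subst lborel.nn_integral_fst[symmetric]) auto
  show ?thesis
  proof (cases "sin \<theta> = 0")
    case True
    then have c: "cos \<theta> \<noteq> 0" "\<bar>cos \<theta>\<bar> = 1"
      using sin_cos_squared_add[of \<theta>] by (auto simp: power2_eq_1_iff)
    have "(\<integral>\<^sup>+z. f z \<partial>lborel) = (\<integral>\<^sup>+r. \<integral>\<^sup>+y. f (0 + cos \<theta> * r, y) \<partial>lborel \<partial>lborel)"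
      unfolding rhs using c by (subst nn_integral_real_affine[where c="cos \<theta>" and t=0]) auto
    also have "\<dots> = (\<integral>\<^sup>+r. \<integral>\<^sup>+t. f (0 + cos \<theta> * r, 0 + cos \<theta> * t) \<partial>lborel \<partial>lborel)"
      using c by (subst nn_integral_real_affine[where c="cos \<theta>" and t=0 and f="\<lambda>y. f (0 + cos \<theta> * _, y)"]) auto
    finally show ?thesis using True by (simp add: mult.commute)
  next
    case False
    define s c where "s = sin \<theta>" and "c = cos \<theta>"
    have s: "s \<noteq> 0" and sc: "s * s + c * c = 1"
      using False sin_cos_squared_add[of \<theta>] by (auto simp: s_def c_def power2_eq_square)
    have eq1: "ennreal \<bar>- 1 / s\<bar> * (ennreal \<bar>s\<bar> * I) = I" for I
      unfolding mult.assoc[symmetric] using s by (simp add: abs_divide flip: ennreal_mult)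
    have "(\<integral>\<^sup>+r. \<integral>\<^sup>+t. f (r * c - t * s, r * s + t * c) \<partial>lborel \<partial>lborel)
        = (\<integral>\<^sup>+r. ennreal \<bar>- 1 / s\<bar> * (\<integral>\<^sup>+u. f (u, (r - u * c) / s) \<partial>lborel) \<partial>lborel)"
    proof (intro nn_integral_cong)
      fix r
      have "(\<integral>\<^sup>+t. f (r * c - t * s, r * s + t * c) \<partial>lborel) =
        ennreal \<bar>- 1 / s\<bar> * (\<integral>\<^sup>+u. f (r * c - (r * c / s + (- 1 / s) * u) * s, r * s + (r * c / s + (- 1 / s) * u) * c) \<partial>lborel)"
        using s by (subst nn_integral_real_affine[where c="- 1 / s" and t="r * c / s"]) auto
      also have "(\<lambda>u. f (r * c - (r * c / s + (- 1 / s) * u) * s, r * s + (r * c / s + (- 1 / s) * u) * c)) = (\<lambda>u. f (u, (r - u * c) / s))"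
      proof
        fix u
        have "r * c - (r * c / s + (- 1 / s) * u) * s = u" using s by (simp add: field_simps)
        moreover have "r * s + (r * c / s + (- 1 / s) * u) * c = (r * (s * s + c * c) - u * c) / s"
          using s by (simp add: field_simps)
        ultimately show "f (r * c - (r * c / s + (- 1 / s) * u) * s, r * s + (r * c / s + (- 1 / s) * u) * c) = f (u, (r - u * c) / s)"
          by (simp add: sc)
      qed
      finally show "(\<integral>\<^sup>+t. f (r * c - t * s, r * s + t * c) \<partial>lborel) = ennreal \<bar>- 1 / s\<bar> * (\<integral>\<^sup>+u. f (u, (r - u * c) / s) \<partial>lborel)" .
    qed
    also have "\<dots> = ennreal \<bar>- 1 / s\<bar> * (\<integral>\<^sup>+r. (\<integral>\<^sup>+u. f (u, (r - u * c) / s) \<partial>lborel) \<partial>lborel)"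
      by (rule nn_integral_cmult) measurable
    also have "(\<integral>\<^sup>+r. (\<integral>\<^sup>+u. f (u, (r - u * c) / s) \<partial>lborel) \<partial>lborel) = (\<integral>\<^sup>+u. (\<integral>\<^sup>+r. f (u, (r - u * c) / s) \<partial>lborel) \<partial>lborel)"
      by (rule lborel_pair.Fubini') measurable
    also have "\<dots> = (\<integral>\<^sup>+u. ennreal \<bar>s\<bar> * (\<integral>\<^sup>+v. f (u, v) \<partial>lborel) \<partial>lborel)"
    proof (intro nn_integral_cong)
      fix u
      show "(\<integral>\<^sup>+r. f (u, (r - u * c) / s) \<partial>lborel) = ennreal \<bar>s\<bar> * (\<integral>\<^sup>+v. f (u, v) \<partial>lborel)"
        using s by (subst nn_integral_real_affine[where c=s and t="u * c"]) auto
    qed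
    also have "\<dots> = ennreal \<bar>s\<bar> * (\<integral>\<^sup>+z. f z \<partial>lborel)"
      unfolding rhs by (rule nn_integral_cmult) measurable
    finally show ?thesis
      unfolding eq1 unfolding s_def c_def .
  qed
qed

section \<open>Lengths of lines inside a window\<close>

lemma norm_line_pt: "(norm (line_pt l t))\<^sup>2 = (snd l)\<^sup>2 + t\<^sup>2"
proof -
  have "(norm (line_pt l t))\<^sup>2 = (snd l * cos (fst l) - t * sin (fst l))\<^sup>2 + (snd l * sin (fst l) + t * cos (fst l))\<^sup>2"
    by (simp add: line_pt_def norm_prod_def)
  also have "\<dots> = ((snd l)\<^sup>2 + t\<^sup>2) * ((sin (fst l))\<^sup>2 + (cos (fst l))\<^sup>2)"
    unfolding power2_eq_square by algebra
  finally show ?thesis by simp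
qed

text \<open>A window inside the ball of radius \<open>R\<close> thus meets only lines with offset at
  most \<open>R\<close>, and each of them only at parameters \<open>t\<close> in
  \<open>{- R..R}\<close>.\<close>

lemma abs_le_norm_line_pt: "\<bar>snd l\<bar> \<le> norm (line_pt l t)" "\<bar>t\<bar> \<le> norm (line_pt l t)"
  using norm_line_pt[of l t] by (auto intro!: abs_le_square_iff[THEN iffD2, of _ "norm _", simplified])

lemma line_pt_measurable[measurable]: "(\<lambda>(l, t). line_pt l t) \<in> borel_measurable (borel \<Otimes>\<^sub>M borel)"
  unfolding line_pt_def by (simp add: borel_prod[symmetric] case_prod_beta')

lemma line_pt_measurable'[measurable]: "line_pt l \<in> borel_measurable borel"
  unfolding line_pt_def by (simp add: borel_prod[symmetric])

text \<open>\<open>line_len\<close> uses the real-valued \<open>measure\<close>, which is 0 on sets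
  of infinite measure; boundedness of the window excludes this default.\<close>

lemma ennreal_line_len:
  assumes A: "A \<in> sets borel" "bounded A"
  shows "ennreal (line_len l A) = (\<integral>\<^sup>+t. indicator A (line_pt l t) \<partial>lborel)"
proof -
  note [measurable] = A(1)
  obtain R where R: "\<And>x. x \<in> A \<Longrightarrow> norm x \<le> R" using A(2) by (auto simp: bounded_iff)
  have "{t. line_pt l t \<in> A} \<subseteq> {- R..R}"
  proof
    fix t assume "t \<in> {t. line_pt l t \<in> A}"
    then show "t \<in> {- R..R}"
      using R[of "line_pt l t"] abs_le_norm_line_pt(2)[of t l] by auto
  qed
  then have "emeasure lborel {t. line_pt l t \<in> A} \<le> emeasure lborel {- R..R}"
    by (intro emeasure_mono) auto
  also have "\<dots> < \<infinity>" by (simp add: emeasure_lborel_Icc_eq)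
  finally have "emeasure lborel {t. line_pt l t \<in> A} < \<infinity>" .
  then have "ennreal (line_len l A) = emeasure lborel {t. line_pt l t \<in> A}"
    by (simp add: line_len_def emeasure_eq_ennreal_measure less_top)
  also have "\<dots> = (\<integral>\<^sup>+t. indicator {t. line_pt l t \<in> A} t \<partial>lborel)"
    by (rule nn_integral_indicator[symmetric]) measurable
  finally show ?thesis by (simp add: indicator_def)
qed

text \<open>For a fixed direction the parallel lines sweep out the plane isometrically, so their
  lengths in \<open>A\<close> integrate to the area of \<open>A\<close>. Integrating over the
  directions gives the factor \<open>2 * pi\<close>, which the normalisation in
  \<open>hom_plp\<close> removes.\<close>

lemma nn_integral_line_len:
  fixes A :: "point set"
  assumes A: "A \<in> sets borel" "bounded A"
  shows "(\<integral>\<^sup>+l. indicator ({0..<2 * pi} \<times> UNIV) l * ennreal (line_len l A) \<partial>lborel) = ennreal (2 * pi) * emeasure lborel A"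
proof -
  note [measurable] = A(1)
  have [measurable]: "(\<lambda>l. ennreal (line_len l A)) \<in> borel_measurable (borel \<Otimes>\<^sub>M borel)"
  proof -
    have "(\<lambda>l. \<integral>\<^sup>+t. indicator A (line_pt l t) \<partial>lborel) \<in> borel_measurable borel"
      by measurable
    then show ?thesis by (simp add: ennreal_line_len[OF A] borel_prod)
  qed
  have S: "{0..<2 * pi} \<times> (UNIV :: real set) \<in> sets (borel \<Otimes>\<^sub>M borel)" by simp
  have "(\<integral>\<^sup>+l. indicator ({0..<2 * pi} \<times> UNIV) l * ennreal (line_len l A) \<partial>lborel) =
    (\<integral>\<^sup>+\<theta>. \<integral>\<^sup>+r. indicator {0..<2 * pi} \<theta> * ennreal (line_len (\<theta>, r) A) \<partial>lborel \<partial>lborel)"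
    using S by (subst lborel_prod[symmetric], subst lborel.nn_integral_fst[symmetric])
       (auto simp: indicator_times)
  also have "\<dots> = (\<integral>\<^sup>+\<theta>. indicator {0..<2 * pi} \<theta> * (\<integral>\<^sup>+r. ennreal (line_len (\<theta>, r) A) \<partial>lborel) \<partial>lborel)"
    by (intro nn_integral_cong nn_integral_cmult) measurable
  also have "\<dots> = (\<integral>\<^sup>+\<theta>. indicator {0..<2 * pi} \<theta> * emeasure lborel A \<partial>lborel)"
  proof (intro nn_integral_cong arg_cong2[where f="(*)"] refl)
    fix \<theta> :: real
    have "(\<integral>\<^sup>+r. ennreal (line_len (\<theta>, r) A) \<partial>lborel)
        = (\<integral>\<^sup>+r. \<integral>\<^sup>+t. indicator A (r * cos \<theta> - t * sin \<theta>, r * sin \<theta> + t * cos \<theta>) \<partial>lborel \<partial>lborel)"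
      by (simp add: ennreal_line_len[OF A] line_pt_def)
    also have "\<dots> = (\<integral>\<^sup>+z. indicator A z \<partial>lborel)"
      by (rule nn_integral_rotate) measurable
    finally show "(\<integral>\<^sup>+r. ennreal (line_len (\<theta>, r) A) \<partial>lborel) = emeasure lborel A" by simp
  qed
  also have "\<dots> = ennreal (2 * pi) * emeasure lborel A"
    by (simp add: nn_integral_multc)
  finally show ?thesis .
qed

lemma bounded_emeasure_lborel_finite: "bounded A \<Longrightarrow> A \<in> sets borel \<Longrightarrow> emeasure lborel A < \<infinity>"
  for A :: "'a::euclidean_space set"
  using emeasure_bounded_finite by auto

text \<open>The intensity vanishes off the strip, so each bounded part of the complement is almost
  surely free of points. Without the bound on the angle, local finiteness in the parameters would
  not prevent infinitely many lines from meeting a bounded window.\<close>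

lemma hom_plp_AE_directions:
  assumes "prob_space M" "hom_plp M L lamL"
  shows "AE \<omega> in M. L \<omega> \<subseteq> {0..<2 * pi} \<times> UNIV"
proof -
  interpret prob_space M by fact
  let ?S = "{0..<2 * pi} \<times> (UNIV :: real set)"
  have pp: "poisson_pp M L (\<lambda>A. lamL / (2 * pi) * measure lborel (A \<inter> ?S))"
    using assms by (simp add: hom_plp_def)
  then have fin: "\<omega> \<in> space M \<Longrightarrow> finite (L \<omega> \<inter> (ball 0 (real n) - ?S))" for \<omega> n
    by (intro point_process_finite[of M L] bounded_diff) (simp_all add: poisson_pp_def)
  have "AE \<omega> in M. card (L \<omega> \<inter> (ball 0 (real n) - ?S)) = 0" for n
  proof -
    have m: "ball 0 (real n) - ?S \<in> sets borel"
    proof (rule sets.Diff)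
      show "?S \<in> sets borel" by (simp flip: borel_prod)
    qed simp
    have p1: "prob {\<omega> \<in> space M. card (L \<omega> \<inter> (ball 0 (real n) - ?S)) = 0} = 1"
    proof -
      have "(ball 0 (real n) - ?S) \<inter> ?S = {}" by blast
      then show ?thesis
        using poisson_pp_prob_card[OF pp m, of 0] by (simp only: bounded_diff[OF bounded_ball]) (simp add: poisson_prob_def)
    qed
    show ?thesis
      by (rule AE_mp[OF AE_prob_1[OF p1]]) simp
  qed
  then have "AE \<omega> in M. \<forall>n. card (L \<omega> \<inter> (ball 0 (real n) - ?S)) = 0"
    by (simp add: AE_all_countable)
  then show ?thesis
  proof (rule AE_mp, intro AE_I2 impI subsetI)
    fix \<omega> x assume \<omega>: "\<omega> \<in> space M" "\<forall>n. card (L \<omega> \<inter> (ball 0 (real n) - ?S)) = 0" "x \<in> L \<omega>"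
    obtain n :: nat where "norm x < real n" using reals_Archimedean2 by blast
    \<comment> \<open>Local finiteness excludes that the count is 0 merely because the set is
      infinite.\<close>
    moreover have "L \<omega> \<inter> (ball 0 (real n) - ?S) = {}"
      using \<omega>(2)[rule_format, of n] fin[OF \<omega>(1), of n] by (simp only: card_0_eq)
    ultimately show "x \<in> ?S" using \<omega>(3) by auto
  qed
qed

lemma lines_len_nonneg: "0 \<le> lines_len L A"
  unfolding lines_len_def line_len_def by (intro sum_nonneg) simp

text \<open>Lines that miss \<open>A\<close> contribute 0. Those that hit it have parameters in a
  bounded box and are finite in number, which matters because a \<open>sum\<close> over an infinite
  set is 0 by default.\<close>

lemma lines_len_eq_sum:
  assumes A: "A \<in> sets borel" "bounded A" and L: "locally_finite L" "L \<subseteq> {0..<2 * pi} \<times> UNIV"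
  shows "ennreal (lines_len L A) = (\<integral>\<^sup>+l. ennreal (line_len l A) \<partial>count_space L)"
proof -
  let ?H = "{l\<in>L. line_set l \<inter> A \<noteq> {}}"
  obtain R where R: "\<And>x. x \<in> A \<Longrightarrow> norm x \<le> R" using A(2) by (auto simp: bounded_iff)
  have "?H \<subseteq> L \<inter> ({0..2 * pi} \<times> {- R..R})"
  proof
    fix l assume l: "l \<in> ?H"
    then obtain t where "line_pt l t \<in> A" by (auto simp: line_set_def)
    from R[OF this] have "\<bar>snd l\<bar> \<le> R" using abs_le_norm_line_pt(1)[of l t] by linarith
    moreover have "fst l \<in> {0..<2 * pi}" using l L(2) by auto
    ultimately show "l \<in> L \<inter> ({0..2 * pi} \<times> {- R..R})" using l by (cases l) auto
  qed
  moreover have "finite (L \<inter> ({0..2 * pi} \<times> {- R..R}))"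
    using L(1) by (simp add: locally_finite_def bounded_Times)
  ultimately have fin: "finite ?H" by (rule finite_subset)
  have "ennreal (line_len l A) = 0" if "l \<in> L - ?H" for l
  proof -
    have "{t. line_pt l t \<in> A} = {}" using that by (auto simp: line_set_def)
    then show ?thesis by (simp add: line_len_def)
  qed
  then have "(\<integral>\<^sup>+l. ennreal (line_len l A) \<partial>count_space L) = (\<Sum>l\<in>?H. ennreal (line_len l A))"
    using fin by (intro nn_integral_count_space') auto
  also have "\<dots> = ennreal (lines_len L A)"
    unfolding lines_len_def by (rule sum_ennreal) (simp add: line_len_def)
  finally show ?thesis by simp
qed

text \<open>Campbell's formula for the line parameters, combined with the integral over all lines;
  this confirms that \<open>lamL\<close> is the mean line length per unit area.\<close>

lemma hom_plp_mean_length: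
  assumes M: "prob_space M" and L: "hom_plp M L lamL" and lamL: "0 \<le> lamL"
    and A: "A \<in> sets borel" "bounded A"
  shows "(\<integral>\<^sup>+\<omega>. \<integral>\<^sup>+l. ennreal (line_len l A) \<partial>count_space (L \<omega>) \<partial>M) = ennreal lamL * emeasure lborel A" (is ?mean)
    and "(\<lambda>\<omega>. \<integral>\<^sup>+l. ennreal (line_len l A) \<partial>count_space (L \<omega>)) \<in> borel_measurable M" (is ?meas)
proof -
  interpret prob_space M by fact
  let ?S = "{0..<2 * pi} \<times> (UNIV :: real set)"
  have S[measurable]: "?S \<in> sets borel" by (simp flip: borel_prod)
  note [measurable] = A(1)
  \<comment> \<open>The intensity in \<open>hom_plp\<close> is a real-valued set function; \<nu> is
    a measure that agrees with it on bounded Borel sets.\<close>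
  define \<nu> where "\<nu> = density lborel (\<lambda>l. ennreal (lamL / (2 * pi)) * indicator ?S l)"
  have len[measurable]: "(\<lambda>l. ennreal (line_len l A)) \<in> borel_measurable borel"
    unfolding ennreal_line_len[OF A] by measurable
  have pp: "poisson_pp M L (\<lambda>A. lamL / (2 * pi) * measure lborel (A \<inter> ?S))"
    using L by (simp add: hom_plp_def)
  have nu_eq: "emeasure \<nu> B = ennreal (lamL / (2 * pi) * measure lborel (B \<inter> ?S))" if "B \<in> sets borel" "bounded B" for B
  proof -
    have "emeasure \<nu> B = (\<integral>\<^sup>+l. ennreal (lamL / (2 * pi)) * indicator (B \<inter> ?S) l \<partial>lborel)"
      unfolding \<nu>_def using that by (subst emeasure_density) (auto intro!: nn_integral_cong simp: indicator_def)
    also have "\<dots> = ennreal (lamL / (2 * pi)) * emeasure lborel (B \<inter> ?S)"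
      using that S by (intro nn_integral_cmult_indicator) auto
    also have "emeasure lborel (B \<inter> ?S) = ennreal (measure lborel (B \<inter> ?S))"
      using bounded_emeasure_lborel_finite[of "B \<inter> ?S"] that S bounded_subset[OF that(2) Int_lower1]
      by (intro emeasure_eq_ennreal_measure) auto
    also have "ennreal (lamL / (2 * pi)) * \<dots> = ennreal (lamL / (2 * pi) * measure lborel (B \<inter> ?S))"
      by (rule ennreal_mult[symmetric]) (use lamL in auto)
    finally show ?thesis .
  qed
  interpret sigma_finite_measure \<nu>
    unfolding \<nu>_def by (subst sigma_finite_measure.sigma_finite_iff_density_finite[OF lborel.sigma_finite_measure_axioms]) (auto simp: indicator_def)
  \<comment> \<open>The summand depends on the line alone, so the mark is the constant of type
    \<open>unit\<close>.\<close>
  interpret independent_mark M L "\<lambda>_. ()" "count_space UNIV" \<nu>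
  proof
    show "point_process M L" using pp by (simp add: poisson_pp_def)
    show "(\<lambda>_. ()) \<in> measurable M (count_space UNIV)" by simp
    show "sets \<nu> = sets borel" by (simp add: \<nu>_def)
    fix B :: "(real \<times> real) set" assume B: "B \<in> sets borel" "bounded B"
    show "(\<integral>\<^sup>+\<omega>. of_nat (card (L \<omega> \<inter> B)) \<partial>M) = emeasure \<nu> B"
      using poisson_pp_mean[OF M pp B] lamL by (simp add: nu_eq[OF B])
    show "emeasure \<nu> B < \<infinity>" by (simp add: nu_eq[OF B])
    fix E :: "unit set" and k
    show "prob {\<omega> \<in> space M. card (L \<omega> \<inter> B) = k \<and> () \<in> E} = prob {\<omega> \<in> space M. card (L \<omega> \<inter> B) = k} * prob {\<omega> \<in> space M. () \<in> E}"
      by (cases "() \<in> E") (simp_all add: prob_space)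
  qed
  have "(\<integral>\<^sup>+\<omega>. \<integral>\<^sup>+l. ennreal (line_len l A) \<partial>count_space (L \<omega>) \<partial>M) = (\<integral>\<^sup>+l. ennreal (line_len l A) \<partial>\<nu>)"
    using campbell[of "\<lambda>(l, _). ennreal (line_len l A)"] by (simp add: emeasure_space_1)
  also have "\<dots> = (\<integral>\<^sup>+l. ennreal (lamL / (2 * pi)) * (indicator ?S l * ennreal (line_len l A)) \<partial>lborel)"
    unfolding \<nu>_def by (subst nn_integral_density) (auto simp: mult.assoc)
  also have "\<dots> = ennreal (lamL / (2 * pi)) * (ennreal (2 * pi) * emeasure lborel A)"
    by (subst nn_integral_cmult) (auto simp: nn_integral_line_len[OF A])
  also have "\<dots> = ennreal lamL * emeasure lborel A"
    using lamL by (simp add: mult.assoc[symmetric] flip: ennreal_mult)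
  finally show ?mean .
  show ?meas
    using sum_points_measurable[OF U, of "\<lambda>(l, _). ennreal (line_len l A)"] by simp
qed

text \<open>Given the lines, the count is Poisson with mean \<open>lam\<close> times the line length
  in \<open>A\<close>; averaging over the lines leaves \<open>lam\<close> times the mean
  length.\<close>

lemma cox_mean:
  assumes M: "prob_space M" and L: "hom_plp M L lamL" and lam: "0 \<le> lamL" "0 \<le> lam"
    and cox: "cox_on_lines M L U lam" and A: "A \<in> sets borel" "bounded A"
  shows "(\<integral>\<^sup>+\<omega>. of_nat (card (U \<omega> \<inter> A)) \<partial>M) = ennreal (lamL * lam) * emeasure lborel A"
proof -
  interpret prob_space M by fact
  \<comment> \<open>\<open>G\<close> is a measurable function that almost surely equals
    \<open>lines_len (L \<omega>) A\<close>; with it the series over \<open>k\<close> and the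
    expectation can be exchanged.\<close>
  define G where "G \<omega> = (\<integral>\<^sup>+l. ennreal (line_len l A) \<partial>count_space (L \<omega>))" for \<omega>
  note G = hom_plp_mean_length[OF M L lam(1) A, folded G_def]
  note [measurable] = G(2)
  have pp: "point_process M U" and ppL: "point_process M L"
    using cox L by (auto simp: cox_on_lines_def hom_plp_def poisson_pp_def)
  have AE: "AE \<omega> in M. G \<omega> = ennreal (lines_len (L \<omega>) A)"
    using hom_plp_AE_directions[OF M L]
  proof (rule AE_mp, intro AE_I2 impI)
    fix \<omega> assume "\<omega> \<in> space M" "L \<omega> \<subseteq> {0..<2 * pi} \<times> UNIV"
    then show "G \<omega> = ennreal (lines_len (L \<omega>) A)"
      using ppL unfolding G_def
      by (intro lines_len_eq_sum[OF A, symmetric]) (auto simp: point_process_def locally_finite_def)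
  qed
  \<comment> \<open>The sure event is the count event with no windows; inserting it for
    \<open>B\<close> in the Cox property gives the unconditional law.\<close>
  have "space M \<in> count_events M L"
    unfolding count_events_def by (intro CollectI exI[of _ "0::nat"]) auto
  then have cox1: "emeasure M (space M \<inter> {\<omega> \<in> space M. \<forall>i<1::nat. card (U \<omega> \<inter> A) = k})
      = (\<integral>\<^sup>+\<omega>. indicator (space M) \<omega> * ennreal (\<Prod>i<1::nat. poisson_prob (lam * lines_len (L \<omega>) A) k) \<partial>M)" for k
    using cox[unfolded cox_on_lines_def, THEN conjunct2, rule_format, of "space M" 1 "\<lambda>_. A" "\<lambda>_. k"] A
    by (simp add: disjoint_family_on_def)
  have prob_k: "emeasure M {\<omega> \<in> space M. card (U \<omega> \<inter> A) = k}
      = (\<integral>\<^sup>+\<omega>. ennreal (poisson_prob (lam * enn2real (G \<omega>)) k) \<partial>M)" for k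
  proof -
    have "emeasure M {\<omega> \<in> space M. card (U \<omega> \<inter> A) = k}
        = (\<integral>\<^sup>+\<omega>. indicator (space M) \<omega> * ennreal (\<Prod>i<1::nat. poisson_prob (lam * lines_len (L \<omega>) A) k) \<partial>M)"
    proof -
      have "space M \<inter> {\<omega> \<in> space M. \<forall>i<1::nat. card (U \<omega> \<inter> A) = k} = {\<omega> \<in> space M. card (U \<omega> \<inter> A) = k}"
        by auto
      then show ?thesis by (simp only: cox1[symmetric])
    qed
    also have "\<dots> = (\<integral>\<^sup>+\<omega>. ennreal (poisson_prob (lam * enn2real (G \<omega>)) k) \<partial>M)"
      by (rule nn_integral_cong_AE, rule AE_mp[OF AE]) (simp add: lines_len_nonneg)
    finally show ?thesis .
  qed
  have "(\<integral>\<^sup>+\<omega>. of_nat (card (U \<omega> \<inter> A)) \<partial>M)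
      = (\<Sum>k. of_nat k * (\<integral>\<^sup>+\<omega>. ennreal (poisson_prob (lam * enn2real (G \<omega>)) k) \<partial>M))"
    using point_process_card_measurable[OF pp A] by (simp add: nn_integral_of_nat prob_k)
  also have "\<dots> = (\<integral>\<^sup>+\<omega>. (\<Sum>k. of_nat k * ennreal (poisson_prob (lam * enn2real (G \<omega>)) k)) \<partial>M)"
    unfolding poisson_prob_def by (subst nn_integral_suminf) (measurable, simp add: nn_integral_cmult)
  also have "\<dots> = (\<integral>\<^sup>+\<omega>. ennreal (lam * enn2real (G \<omega>)) \<partial>M)"
    using lam by (simp add: suminf_poisson_prob_mean)
  also have "\<dots> = (\<integral>\<^sup>+\<omega>. ennreal lam * G \<omega> \<partial>M)"
    by (rule nn_integral_cong_AE, rule AE_mp[OF AE])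
       (simp add: lam ennreal_mult lines_len_nonneg)
  also have "\<dots> = ennreal lam * (ennreal lamL * emeasure lborel A)"
    by (simp add: nn_integral_cmult G(1))
  finally show ?thesis
    using lam by (simp add: ennreal_mult mult_ac)
qed

section \<open>Cells and reflection\<close>

lemma conf_bex_measurable:
  assumes f: "f \<in> measurable M conf" and P: "Measurable.pred (borel \<Otimes>\<^sub>M M) (\<lambda>z. P (fst z) (snd z))"
  shows "Measurable.pred M (\<lambda>\<omega>. \<exists>x\<in>f \<omega>. P x \<omega>)"
  using P by (intro bex_points_measurable[of M f]) (simp_all add: point_process_iff f case_prod_beta')

lemma conf_ball_measurable:
  assumes f: "f \<in> measurable M conf" and P: "Measurable.pred (borel \<Otimes>\<^sub>M M) (\<lambda>z. P (fst z) (snd z))"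
  shows "Measurable.pred M (\<lambda>\<omega>. \<forall>x\<in>f \<omega>. P x \<omega>)"
  using P by (intro ball_points_measurable[of M f]) (simp_all add: point_process_iff f case_prod_beta')

lemma voronoi_measurable[measurable (raw)]:
  assumes [measurable]: "f \<in> measurable M conf" "g \<in> borel_measurable M" "h \<in> borel_measurable M"
  shows "Measurable.pred M (\<lambda>\<omega>. g \<omega> \<in> voronoi (f \<omega>) (h \<omega>))"
  unfolding voronoi_def mem_Collect_eq by (rule conf_ball_measurable) measurable

lemma hpow_measurable:
  assumes [measurable]: "f \<in> measurable M conf" "h \<in> borel_measurable M"
  shows "(\<lambda>\<omega>. hpow (f \<omega>) Pmac Pmic (h \<omega>)) \<in> borel_measurable M"
proof -
  \<comment> \<open>Membership of a random point in a random configuration, written as an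
    existential over the points of the configuration.\<close>
  have "Measurable.pred M (\<lambda>\<omega>. \<exists>x\<in>f \<omega>. x = h \<omega>)"
    by (rule conf_bex_measurable) measurable
  then have [measurable]: "Measurable.pred M (\<lambda>\<omega>. h \<omega> \<in> f \<omega>)" by simp
  show ?thesis unfolding hpow_def by measurable
qed

lemma hetcell_measurable[measurable (raw)]:
  assumes [measurable]: "f \<in> measurable M conf" "f' \<in> measurable M conf"
    "g \<in> borel_measurable M" "h \<in> borel_measurable M"
  shows "Measurable.pred M (\<lambda>\<omega>. g \<omega> \<in> hetcell (f \<omega>) (f' \<omega>) Pmac Pmic \<beta> (h \<omega>))"
proof -
  have [measurable]: "(\<lambda>\<omega>. hpow (f \<omega>) Pmac Pmic (h \<omega>)) \<in> borel_measurable M"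
    "(\<lambda>z. hpow (f (snd z)) Pmac Pmic (fst z)) \<in> borel_measurable (borel \<Otimes>\<^sub>M M)"
    by (rule hpow_measurable; measurable)+
  have "Measurable.pred M (\<lambda>\<omega>. \<forall>y\<in>F \<omega>. hpow (f \<omega>) Pmac Pmic y * dist (h \<omega>) (g \<omega>) powr \<beta>
      \<le> hpow (f \<omega>) Pmac Pmic (h \<omega>) * dist y (g \<omega>) powr \<beta>)" if "F \<in> measurable M conf" for F
    using that by (rule conf_ball_measurable) measurable
  from this[of f] this[of f'] show ?thesis
    unfolding hetcell_def mem_Collect_eq ball_Un by measurable
qed

text \<open>The station is quantified rather than named by \<open>closest\<close>: an existential
  over the points is measurable, and a reflection merely moves the witness \<open>y\<close> to
  \<open>x - y\<close>. Almost surely the origin has a single nearest macro station, and then the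
  witness is \<open>closest\<close>.\<close>

definition macro_event :: "real \<Rightarrow> real \<Rightarrow> real \<Rightarrow> point \<Rightarrow> point set \<times> point set \<Rightarrow> bool" where
  "macro_event Pmac Pmic \<beta> x \<Phi> \<longleftrightarrow>
     (\<exists>y\<in>fst \<Phi>. (0, 0) \<in> voronoi (fst \<Phi>) y \<and> x \<in> voronoi (fst \<Phi>) y \<and> (0, 0) \<in> hetcell (fst \<Phi>) (snd \<Phi>) Pmac Pmic \<beta> y)"

definition het_event :: "real \<Rightarrow> real \<Rightarrow> real \<Rightarrow> point \<Rightarrow> point set \<times> point set \<Rightarrow> bool" where
  "het_event Pmac Pmic \<beta> x \<Phi> \<longleftrightarrow>
     (\<exists>y\<in>fst \<Phi>. (0, 0) \<in> voronoi (fst \<Phi>) y \<and> x \<in> hetcell (fst \<Phi>) (snd \<Phi>) Pmac Pmic \<beta> y)"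

lemma macro_event_measurable:
  "Measurable.pred (borel \<Otimes>\<^sub>M (conf \<Otimes>\<^sub>M conf)) (\<lambda>z. macro_event Pmac Pmic \<beta> (fst z) (snd z))"
  unfolding macro_event_def by (rule conf_bex_measurable) measurable

lemma het_event_measurable:
  "Measurable.pred (borel \<Otimes>\<^sub>M (conf \<Otimes>\<^sub>M conf)) (\<lambda>z. het_event Pmac Pmic \<beta> (fst z) (snd z))"
  unfolding het_event_def by (rule conf_bex_measurable) measurable

lemma hetcell_subset_voronoi:
  assumes "0 < Pmac" "0 < \<beta>" "y \<in> \<phi>"
  shows "hetcell \<phi> \<psi> Pmac Pmic \<beta> y \<subseteq> voronoi \<phi> y"
proof
  fix z assume z: "z \<in> hetcell \<phi> \<psi> Pmac Pmic \<beta> y"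
  have "dist y z \<le> dist y' z" if "y' \<in> \<phi>" for y'
  proof (rule ccontr)
    assume "\<not> dist y z \<le> dist y' z"
    then have "dist y' z powr \<beta> < dist y z powr \<beta>"
      using assms by (intro powr_less_mono2) auto
    moreover have "Pmac * dist y z powr \<beta> \<le> Pmac * dist y' z powr \<beta>"
      using z that assms by (force simp: hetcell_def hpow_def)
    ultimately show False using assms(1) by simp
  qed
  then show "z \<in> voronoi \<phi> y" by (simp add: voronoi_def)
qed

text \<open>Passes to an event of the macro process alone, whose probability is controlled by void
  probabilities.\<close>

lemma het_event_imp:
  assumes "0 < Pmac" "0 < \<beta>" "het_event Pmac Pmic \<beta> x \<Phi>"
  shows "\<exists>y\<in>fst \<Phi>. (0, 0) \<in> voronoi (fst \<Phi>) y \<and> x \<in> voronoi (fst \<Phi>) y"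
  using assms hetcell_subset_voronoi unfolding het_event_def by blast

section \<open>Behaviour of the cells under reflection\<close>

lemma dist_reflect: "dist (x - y) z = dist y (x - z)"
  for x y z :: "'a::real_normed_vector"
  by (simp add: dist_norm norm_minus_commute algebra_simps)

lemma voronoi_reflect:
  "z \<in> voronoi ((\<lambda>y. x - y) ` \<phi>) (x - y) \<longleftrightarrow> x - z \<in> voronoi \<phi> y"
  by (simp add: voronoi_def dist_reflect)

lemma hpow_reflect: "hpow ((\<lambda>y. x - y) ` \<phi>) Pmac Pmic (x - y) = hpow \<phi> Pmac Pmic y"
  by (auto simp: hpow_def reflect_image)

lemma hetcell_reflect:
  "z \<in> hetcell ((\<lambda>y. x - y) ` \<phi>) ((\<lambda>y. x - y) ` \<psi>) Pmac Pmic \<beta> (x - y) \<longleftrightarrow> x - z \<in> hetcell \<phi> \<psi> Pmac Pmic \<beta> y"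
  by (simp add: hetcell_def dist_reflect hpow_reflect ball_Un)

lemma het_event_reflect:
  assumes "0 < Pmac" "0 < \<beta>"
  shows "het_event Pmac Pmic \<beta> x ((\<lambda>y. x - y) ` \<phi>, (\<lambda>y. x - y) ` \<psi>) \<longleftrightarrow> macro_event Pmac Pmic \<beta> x (\<phi>, \<psi>)"
proof -
  have z: "x - (0, 0) = x" "x - x = (0, 0)" by (simp_all flip: zero_prod_def)
  \<comment> \<open>Supplies the conjunct of \<open>macro_event\<close> that the reflection of
    \<open>het_event\<close> does not produce.\<close>
  have "(0, 0) \<in> voronoi \<phi> y" if "y \<in> \<phi>" "(0, 0) \<in> hetcell \<phi> \<psi> Pmac Pmic \<beta> y" for y
    using hetcell_subset_voronoi[OF assms that(1)] that(2) by blast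
  moreover have "(\<exists>y\<in>(\<lambda>y. x - y) ` \<phi>. P y) \<longleftrightarrow> (\<exists>y\<in>\<phi>. P (x - y))" for P
    by blast
  ultimately show ?thesis
    unfolding het_event_def macro_event_def fst_conv snd_conv
    by (simp only: voronoi_reflect hetcell_reflect z) blast
qed

section \<open>Almost sure existence and uniqueness of the closest station\<close>

lemma closest_unique:
  assumes "locally_finite \<phi>" "\<phi> \<noteq> {}" and inj: "\<forall>y\<in>\<phi>. \<forall>y'\<in>\<phi>. norm y = norm y' \<longrightarrow> y = y'"
  shows "closest \<phi> \<in> \<phi>" "y \<in> \<phi> \<Longrightarrow> (0, 0) \<in> voronoi \<phi> y \<longleftrightarrow> y = closest \<phi>"
proof -
  obtain a where a: "a \<in> \<phi>" using assms by blast
  \<comment> \<open>The closed ball through some point \<open>a\<close> contains every competitor of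
    \<open>a\<close> and only finitely many points, so a minimum exists there and is global.\<close>
  have fin: "finite (\<phi> \<inter> cball 0 (norm a))" using assms(1) by (simp add: locally_finite_def)
  define x where "x = arg_min_on norm (\<phi> \<inter> cball 0 (norm a))"
  have ne: "\<phi> \<inter> cball 0 (norm a) \<noteq> {}" using a by auto
  have x: "x \<in> \<phi> \<inter> cball 0 (norm a)" "\<And>y. y \<in> \<phi> \<inter> cball 0 (norm a) \<Longrightarrow> norm x \<le> norm y"
    unfolding x_def using arg_min_if_finite[OF fin ne, of norm] by (metis, metis linorder_not_le)
  have "norm x \<le> norm y" if "y \<in> \<phi>" for y
  proof (cases "norm y \<le> norm a")
    case True then show ?thesis using x(2)[of y] that by simp
  next
    case False then show ?thesis using x(1) by simp
  qed
  then have "\<exists>x. x \<in> \<phi> \<and> (\<forall>y\<in>\<phi>. norm x \<le> norm y)" using x(1) by blast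
  then have c: "closest \<phi> \<in> \<phi> \<and> (\<forall>y\<in>\<phi>. norm (closest \<phi>) \<le> norm y)"
    unfolding closest_def by (rule someI_ex)
  then show "closest \<phi> \<in> \<phi>" by simp
  have vor: "(0, 0) \<in> voronoi \<phi> y \<longleftrightarrow> (\<forall>y'\<in>\<phi>. norm y \<le> norm y')" for y
    by (simp add: voronoi_def dist_norm flip: zero_prod_def)
  \<comment> \<open>In the absence of ties the minimiser picked by \<open>SOME\<close> is the only
    one.\<close>
  show "(0, 0) \<in> voronoi \<phi> y \<longleftrightarrow> y = closest \<phi>" if "y \<in> \<phi>"
    unfolding vor using c that inj[rule_format, of y "closest \<phi>"] by (auto intro: antisym)
qed

lemma hom_ppp_void_prob:
  assumes "hom_ppp M \<Phi> lam" "0 \<le> r"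
  shows "measure M {\<omega> \<in> space M. card (\<Phi> \<omega> \<inter> ball z r) = 0} = exp (- (lam * pi * r\<^sup>2))"
  using poisson_pp_prob_card[OF assms(1)[unfolded hom_ppp_def], of "ball z r" 0] assms(2)
  by (simp add: poisson_prob_def content_ball unit_ball_vol_2 mult.assoc power2_eq_square)

text \<open>The probability that the disc of radius \<open>n\<close> is empty tends to 0, because
  the intensity is positive.\<close>

lemma hom_ppp_AE_nonempty:
  assumes "prob_space M" "hom_ppp M \<Phi> lam" "0 < lam"
  shows "AE \<omega> in M. \<Phi> \<omega> \<noteq> {}"
proof -
  interpret prob_space M by fact
  have pp: "point_process M \<Phi>" using assms by (simp add: hom_ppp_def poisson_pp_def)
  let ?E = "\<lambda>n::nat. {\<omega> \<in> space M. card (\<Phi> \<omega> \<inter> ball 0 (real n)) = 0}"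
  have [measurable]: "?E n \<in> sets M" for n
    using pp by (auto simp: point_process_def)
  have "(\<lambda>n. exp (- (lam * pi * (real n)\<^sup>2))) \<longlonglongrightarrow> 0"
    using assms(3) by real_asymp
  moreover have "prob (\<Inter>n. ?E n) \<le> exp (- (lam * pi * (real n)\<^sup>2))" for n
    unfolding hom_ppp_void_prob[OF assms(2) of_nat_0_le_iff, symmetric, of n 0]
    by (intro finite_measure_mono) auto
  ultimately have "prob (\<Inter>n. ?E n) \<le> 0"
    by (intro LIMSEQ_le_const) auto
  then have "prob (\<Inter>n. ?E n) = 0" by (simp add: measure_le_0_iff)
  then have "AE \<omega> in M. \<omega> \<notin> (\<Inter>n. ?E n)"
    by (subst prob_eq_0[symmetric]) auto
  then show ?thesis
    by (rule AE_mp) auto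
qed

text \<open>From \<open>exp (- r) \<ge> 1 - r\<close>, the probability of at most one point,
  \<open>exp (- r) * (1 + r)\<close>, is at least \<open>1 - r\<^sup>2\<close>. The quadratic order
  is what beats the number of annuli below.\<close>

lemma poisson_prob_ge_2:
  assumes "0 \<le> r"
  shows "1 - poisson_prob r 0 - poisson_prob r 1 \<le> r\<^sup>2"
proof -
  have "(1 - r) * (1 + r) \<le> exp (- r) * (1 + r)"
    using assms exp_ge_add_one_self[of "- r"] by (intro mult_right_mono) auto
  then show ?thesis
    by (simp add: poisson_prob_def power2_eq_square algebra_simps)
qed

lemma hom_ppp_prob_two_points:
  assumes "prob_space M" "hom_ppp M \<Phi> lam" "0 < lam" and A: "A \<in> sets borel" "bounded A"
  shows "measure M {\<omega> \<in> space M. 2 \<le> card (\<Phi> \<omega> \<inter> A)} \<le> (lam * measure lborel A)\<^sup>2"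
proof -
  interpret prob_space M by fact
  have pp: "point_process M \<Phi>" using assms by (simp add: hom_ppp_def poisson_pp_def)
  let ?E = "\<lambda>k. {\<omega> \<in> space M. card (\<Phi> \<omega> \<inter> A) = k}"
  have ev: "?E k \<in> events" for k using pp A by (auto simp: point_process_def)
  have "{\<omega> \<in> space M. 2 \<le> card (\<Phi> \<omega> \<inter> A)} = space M - (?E 0 \<union> ?E 1)"
    by auto
  then have "prob {\<omega> \<in> space M. 2 \<le> card (\<Phi> \<omega> \<inter> A)} = 1 - prob (?E 0 \<union> ?E 1)"
    using ev by (simp only: prob_compl sets.Un)
  also have "prob (?E 0 \<union> ?E 1) = prob (?E 0) + prob (?E 1)"
    using ev by (intro finite_measure_Union) auto
  finally show ?thesis
    using poisson_prob_ge_2[of "lam * measure lborel A"] assms(3)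
      poisson_pp_prob_card[OF assms(2)[unfolded hom_ppp_def] A] by simp
qed

text \<open>Cutting the disc into \<open>n\<close> annuli of area \<open>O(1/n)\<close>, two points at the same distance from the
  origin fall into one annulus, which has probability \<open>n * O(1/n\<^sup>2)\<close>.\<close>

lemma hom_ppp_AE_norm_inj:
  assumes "prob_space M" "hom_ppp M \<Phi> lam" "0 < lam"
  shows "AE \<omega> in M. \<forall>y\<in>\<Phi> \<omega>. \<forall>y'\<in>\<Phi> \<omega>. norm y = norm y' \<longrightarrow> y = y'"
proof -
  interpret prob_space M by fact
  have pp: "point_process M \<Phi>" using assms by (simp add: hom_ppp_def poisson_pp_def)
  then have [measurable]: "\<Phi> \<in> measurable M conf" by (simp add: point_process_iff)
  have "AE \<omega> in M. \<not> (\<exists>y\<in>\<Phi> \<omega>. \<exists>y'\<in>\<Phi> \<omega>. y \<noteq> y' \<and> norm y = norm y' \<and> norm y < real R)" for R :: nat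
  proof -
    let ?T = "{\<omega> \<in> space M. \<exists>y\<in>\<Phi> \<omega>. \<exists>y'\<in>\<Phi> \<omega>. y \<noteq> y' \<and> norm y = norm y' \<and> norm y < real R}"
    have "Measurable.pred M (\<lambda>\<omega>. \<exists>y\<in>\<Phi> \<omega>. \<exists>y'\<in>\<Phi> \<omega>. y \<noteq> y' \<and> norm y = norm y' \<and> norm y < real R)"
      by (rule conf_bex_measurable, measurable, rule conf_bex_measurable) measurable
    then have T: "?T \<in> events" by simp
    have bound: "prob ?T \<le> (2 * lam * pi * (real R)\<^sup>2)\<^sup>2 / real n" if n: "0 < n" for n :: nat
    proof -
      \<comment> \<open>Annuli of equal width, closed inside and open outside, so that every norm
        below \<open>R\<close> belongs to exactly one of them.\<close>
      define ann where "ann i = ball (0::point) (R * real (Suc i) / n) - ball 0 (R * real i / n)" for i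
      have ann: "ann i \<in> sets borel" "bounded (ann i)" for i
        by (auto simp: ann_def intro!: bounded_diff)
      have area: "measure lborel (ann i) \<le> 2 * pi * (real R)\<^sup>2 / n" if "i < n" for i
      proof -
        have le: "R * real i / n \<le> R * real (Suc i) / n"
          by (intro divide_right_mono mult_left_mono) auto
        have "measure lborel (ann i) = pi * (R * real (Suc i) / n)\<^sup>2 - pi * (R * real i / n)\<^sup>2"
        proof -
          have "measure lborel (ann i) = measure lborel (ball (0::point) (R * real (Suc i) / n)) - measure lborel (ball (0::point) (R * real i / n))"
            unfolding ann_def using emeasure_lborel_ball_finite[of "0::point" "R * real (Suc i) / n"]
            by (intro measure_Diff subset_ball le) auto
          then show ?thesis
            by (simp add: content_ball unit_ball_vol_2 power2_eq_square)
        qed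
        also have "\<dots> = pi * (real R)\<^sup>2 * (2 * real i + 1) / (real n)\<^sup>2"
          using n by (simp add: field_simps power2_eq_square)
        \<comment> \<open>Here \<open>2 * i + 1 \<le> 2 * n\<close> because \<open>i < n\<close>;
          the outermost annuli decide the bound on the area.\<close>
        also have "\<dots> \<le> pi * (real R)\<^sup>2 * (2 * real n) / (real n)\<^sup>2"
          using that by (intro divide_right_mono mult_left_mono) auto
        also have "\<dots> = 2 * pi * (real R)\<^sup>2 / n"
          using n by (simp add: field_simps power2_eq_square)
        finally show ?thesis .
      qed
      let ?E = "\<lambda>i. {\<omega> \<in> space M. 2 \<le> card (\<Phi> \<omega> \<inter> ann i)}"
      have ev: "?E i \<in> events" for i
        using point_process_card_measurable[OF pp ann, of i] by measurable
      have "?T \<subseteq> (\<Union>i<n. ?E i)"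
      proof
        fix \<omega> assume "\<omega> \<in> ?T"
        then obtain y y' where \<omega>: "\<omega> \<in> space M" and y: "y \<in> \<Phi> \<omega>" "y' \<in> \<Phi> \<omega>" "y \<noteq> y'" "norm y = norm y'" "norm y < R"
          unfolding mem_Collect_eq by (elim conjE bexE)
        \<comment> \<open>The annulus that contains both points: the norm measured in units of the
          width \<open>R / n\<close>, rounded down.\<close>
        define i where "i = nat \<lfloor>norm y * n / R\<rfloor>"
        have R: "0 < real R" using y(5) norm_ge_zero[of y] by linarith
        have i: "real i \<le> norm y * n / R" "norm y * n / R < real i + 1"
          using R unfolding i_def by (auto simp: le_floor_iff)
        have "norm y * n / R < n" using y(5) R n by (simp add: field_simps)
        then have "i < n" using i(1) by linarith
        have "R * real i / n \<le> norm y" "norm y < R * real (Suc i) / n"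
          using i R n by (auto simp: field_simps)
        then have "{y, y'} \<subseteq> \<Phi> \<omega> \<inter> ann i" using y by (auto simp: ann_def)
        then have "card {y, y'} \<le> card (\<Phi> \<omega> \<inter> ann i)"
          using point_process_finite[OF pp \<omega> ann(2)] by (intro card_mono)
        then have "2 \<le> card (\<Phi> \<omega> \<inter> ann i)" using y(3) by simp
        then show "\<omega> \<in> (\<Union>i<n. ?E i)" using \<omega> \<open>i < n\<close> by (intro UN_I[of i]) simp_all
      qed
      then have "prob ?T \<le> prob (\<Union>i<n. ?E i)"
        using ev by (intro finite_measure_mono) auto
      also have "\<dots> \<le> (\<Sum>i<n. prob (?E i))"
        using ev by (intro finite_measure_subadditive_finite) auto
      also have "\<dots> \<le> (\<Sum>i<n. (lam * (2 * pi * (real R)\<^sup>2 / n))\<^sup>2)"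
      proof (intro sum_mono)
        fix i assume i: "i \<in> {..<n}"
        have "prob (?E i) \<le> (lam * measure lborel (ann i))\<^sup>2"
          by (rule hom_ppp_prob_two_points[OF assms ann])
        also have "\<dots> \<le> (lam * (2 * pi * (real R)\<^sup>2 / n))\<^sup>2"
          using area[of i] i assms(3) by (intro power_mono mult_left_mono) auto
        finally show "prob (?E i) \<le> (lam * (2 * pi * (real R)\<^sup>2 / n))\<^sup>2" .
      qed
      also have "\<dots> = (2 * lam * pi * (real R)\<^sup>2)\<^sup>2 / real n"
        using n by (simp add: field_simps power2_eq_square)
      finally show ?thesis .
    qed
    have "(\<lambda>n. (2 * lam * pi * (real R)\<^sup>2)\<^sup>2 / real n) \<longlonglongrightarrow> 0"
      by (rule lim_const_over_n)
    then have "prob ?T \<le> 0"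
      using bound by (intro LIMSEQ_le_const[where X="\<lambda>n. (2 * lam * pi * (real R)\<^sup>2)\<^sup>2 / real n"]) (auto intro!: exI[of _ 1])
    then have "prob ?T = 0" by (simp add: measure_le_0_iff)
    then have "AE \<omega> in M. \<omega> \<notin> ?T"
      using prob_eq_0[OF T] by simp
    then show ?thesis
      by (rule AE_mp) simp
  qed
  then have "AE \<omega> in M. \<forall>R::nat. \<not> (\<exists>y\<in>\<Phi> \<omega>. \<exists>y'\<in>\<Phi> \<omega>. y \<noteq> y' \<and> norm y = norm y' \<and> norm y < real R)"
    by (simp only: AE_all_countable) simp
  then show ?thesis
  proof (rule AE_mp, intro AE_I2 impI ballI)
    fix \<omega> y y'
    assume *: "\<forall>R::nat. \<not> (\<exists>y\<in>\<Phi> \<omega>. \<exists>y'\<in>\<Phi> \<omega>. y \<noteq> y' \<and> norm y = norm y' \<and> norm y < real R)"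
      "y \<in> \<Phi> \<omega>" "y' \<in> \<Phi> \<omega>" "norm y = norm y'"
    obtain R :: nat where "norm y < R" using reals_Archimedean2 by blast
    with * show "y = y'" by metis
  qed
qed

section \<open>An integrable bound for the cell probabilities\<close>

lemma nn_integral_gaussian_finite:
  assumes "0 < a"
  shows "(\<integral>\<^sup>+x. ennreal (exp (- (a * (norm (x :: point))\<^sup>2))) \<partial>lborel) < \<infinity>"
proof -
  \<comment> \<open>The standard deviation for which the normal density has exponent
    \<open>- (a * t\<^sup>2)\<close>.\<close>
  define \<sigma> where "\<sigma> = sqrt (1 / (2 * a))"
  have \<sigma>: "0 < \<sigma>" "2 * \<sigma>\<^sup>2 = 1 / a" using assms by (simp_all add: \<sigma>_def)
  have eq: "exp (- (a * t\<^sup>2)) = sqrt (2 * pi * \<sigma>\<^sup>2) * normal_density 0 \<sigma> t" for t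
    using \<sigma> by (simp add: normal_density_def mult.commute)
  have "integrable lborel (\<lambda>t::real. exp (- (a * t\<^sup>2)))"
    unfolding eq using \<sigma>(1) by (intro integrable_mult_right) auto
  then have fin: "(\<integral>\<^sup>+t. ennreal (exp (- (a * (t::real)\<^sup>2))) \<partial>lborel) < \<infinity>"
    by (simp add: integrable_iff_bounded)
  have norm: "(norm (s, t))\<^sup>2 = s\<^sup>2 + t\<^sup>2" for s t :: real
    by (simp add: norm_prod_def)
  have m: "(\<lambda>x::point. ennreal (exp (- (a * (norm x)\<^sup>2)))) \<in> borel_measurable (lborel \<Otimes>\<^sub>M lborel)"
    unfolding lborel_prod by measurable
  have "(\<integral>\<^sup>+x. ennreal (exp (- (a * (norm (x :: point))\<^sup>2))) \<partial>lborel)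
      = (\<integral>\<^sup>+s. \<integral>\<^sup>+t. ennreal (exp (- (a * s\<^sup>2))) * ennreal (exp (- (a * t\<^sup>2))) \<partial>lborel \<partial>lborel)"
  proof -
    have "ennreal (exp (- (a * (norm (s, t))\<^sup>2))) = ennreal (exp (- (a * s\<^sup>2))) * ennreal (exp (- (a * t\<^sup>2)))" for s t :: real
      unfolding norm by (simp add: distrib_left mult_exp_exp flip: ennreal_mult)
    then show ?thesis
      by (subst lborel_prod[symmetric], subst lborel.nn_integral_fst[symmetric, OF m]) simp
  qed
  also have "\<dots> = (\<integral>\<^sup>+t. ennreal (exp (- (a * (t::real)\<^sup>2))) \<partial>lborel) * (\<integral>\<^sup>+t. ennreal (exp (- (a * (t::real)\<^sup>2))) \<partial>lborel)"
    by (simp add: nn_integral_cmult nn_integral_multc)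
  also have "\<dots> < \<infinity>" using fin by (simp add: ennreal_mult_less_top)
  finally show ?thesis .
qed

text \<open>If both discs contained a point, the common nearest station would be at distance less
  than \<open>norm x / 2\<close> from the origin and from \<open>x\<close>, against the triangle
  inequality.\<close>

lemma common_voronoi_void:
  assumes "y \<in> \<phi>" "(0, 0) \<in> voronoi \<phi> y" "x \<in> voronoi \<phi> y"
  shows "\<phi> \<inter> ball 0 (norm x / 2) = {} \<or> \<phi> \<inter> ball x (norm x / 2) = {}"
proof (rule ccontr)
  assume "\<not> ?thesis"
  then obtain u v where "u \<in> \<phi>" "norm u < norm x / 2" "v \<in> \<phi>" "dist x v < norm x / 2"
    by auto
  moreover have "norm y \<le> norm u" "dist y x \<le> dist v x"
    using assms(2,3) \<open>u \<in> \<phi>\<close> \<open>v \<in> \<phi>\<close> by (auto simp: voronoi_def dist_norm simp flip: zero_prod_def)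
  moreover have "norm x \<le> norm y + dist y x"
    using dist_triangle[of 0 x y] by (simp add: dist_commute)
  ultimately show False by (simp add: dist_commute)
qed

text \<open>The union bound over the two discs gives the factor 2; their radius
  \<open>norm x / 2\<close> gives the area \<open>pi / 4 * (norm x)\<^sup>2\<close> in the
  exponent.\<close>

lemma hom_ppp_common_voronoi_prob:
  assumes "prob_space M" "hom_ppp M \<Phi> lam"
  shows "emeasure M {\<omega> \<in> space M. \<exists>y\<in>\<Phi> \<omega>. (0, 0) \<in> voronoi (\<Phi> \<omega>) y \<and> x \<in> voronoi (\<Phi> \<omega>) y}
       \<le> ennreal (2 * exp (- (lam * pi / 4 * (norm x)\<^sup>2)))"
proof -
  interpret prob_space M by fact
  have pp: "point_process M \<Phi>" using assms by (simp add: hom_ppp_def poisson_pp_def)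
  let ?E = "\<lambda>z. {\<omega> \<in> space M. card (\<Phi> \<omega> \<inter> ball z (norm x / 2)) = 0}"
  have ev: "?E z \<in> events" for z using pp by (auto simp: point_process_def)
  have "{\<omega> \<in> space M. \<exists>y\<in>\<Phi> \<omega>. (0, 0) \<in> voronoi (\<Phi> \<omega>) y \<and> x \<in> voronoi (\<Phi> \<omega>) y} \<subseteq> ?E 0 \<union> ?E x"
  proof
    fix \<omega> assume "\<omega> \<in> {\<omega> \<in> space M. \<exists>y\<in>\<Phi> \<omega>. (0, 0) \<in> voronoi (\<Phi> \<omega>) y \<and> x \<in> voronoi (\<Phi> \<omega>) y}"
    then obtain y where "\<omega> \<in> space M" and y: "y \<in> \<Phi> \<omega>" "(0, 0) \<in> voronoi (\<Phi> \<omega>) y" "x \<in> voronoi (\<Phi> \<omega>) y"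
      unfolding mem_Collect_eq by (elim conjE bexE)
    then show "\<omega> \<in> ?E 0 \<union> ?E x"
      using common_voronoi_void[OF y] by (elim disjE) simp_all
  qed
  then have "emeasure M {\<omega> \<in> space M. \<exists>y\<in>\<Phi> \<omega>. (0, 0) \<in> voronoi (\<Phi> \<omega>) y \<and> x \<in> voronoi (\<Phi> \<omega>) y}
      \<le> emeasure M (?E 0 \<union> ?E x)"
    using ev by (intro emeasure_mono) auto
  also have "\<dots> \<le> emeasure M (?E 0) + emeasure M (?E x)"
    using ev by (intro emeasure_subadditive)
  also have "\<dots> = ennreal (2 * exp (- (lam * pi / 4 * (norm x)\<^sup>2)))"
    using hom_ppp_void_prob[OF assms(2), of "norm x / 2"]
    by (simp add: emeasure_eq_measure power_divide mult.commute flip: ennreal_plus)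
  finally show ?thesis .
qed

section \<open>From independent counts to independent configurations\<close>

lemma (in prob_space) indep_vars_point_processes:
  assumes pp: "\<And>i. i \<in> I \<Longrightarrow> point_process M (Z i)"
    and ind: "indep_sets (\<lambda>i. count_events M (Z i)) I"
  shows "indep_vars (\<lambda>_. conf) Z I"
  unfolding indep_vars_def2
proof
  show "\<forall>i\<in>I. random_variable conf (Z i)" using pp by (simp add: point_process_iff)
  have "indep_sets (\<lambda>i. sigma_sets (space M) (count_events M (Z i))) I"
    by (rule indep_sets_sigma[OF ind]) (rule Int_stable_count_events)
  then show "indep_sets (\<lambda>i. {Z i -` A \<inter> space M |A. A \<in> sets conf}) I"
    by (rule indep_sets_mono_sets) (auto intro: vimage_conf_sigma_count_events[OF pp])
qed

lemma (in prob_space) indep_vars_imp_indep_var: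
  assumes ind: "indep_vars (\<lambda>_. N) Z I" and ij: "i \<in> I" "j \<in> I" "i \<noteq> j"
  shows "indep_var N (Z i) N (Z j)"
proof -
  have "indep_var N ((\<lambda>f. f i) \<circ> (\<lambda>\<omega>. restrict (\<lambda>i. Z i \<omega>) {i})) N ((\<lambda>f. f j) \<circ> (\<lambda>\<omega>. restrict (\<lambda>i. Z i \<omega>) {j}))"
    using ij by (intro indep_var_compose[OF indep_var_restrict[OF ind]] measurable_component_singleton) auto
  then show ?thesis by (simp add: comp_def)
qed

lemma (in prob_space) indep_vars_prob_pair:
  assumes ind: "indep_vars (\<lambda>_. N) Z I" and ijk: "i \<in> I" "j \<in> I" "k \<in> I" "i \<noteq> k" "j \<noteq> k"
    and C: "C \<in> sets N" and E: "E \<in> sets (N \<Otimes>\<^sub>M N)"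
  shows "prob {\<omega> \<in> space M. Z k \<omega> \<in> C \<and> (Z i \<omega>, Z j \<omega>) \<in> E}
    = prob {\<omega> \<in> space M. Z k \<omega> \<in> C} * prob {\<omega> \<in> space M. (Z i \<omega>, Z j \<omega>) \<in> E}"
proof -
  have comp: "(\<lambda>f. (f i, f j)) \<in> measurable (Pi\<^sub>M J (\<lambda>_. N)) (N \<Otimes>\<^sub>M N)" if "i \<in> J" "j \<in> J" for i j J
    using that by (intro measurable_Pair measurable_component_singleton) auto
  \<comment> \<open>The two variables of \<open>indep_var\<close> share one value type, so
    \<open>Z k\<close> is doubled to match the pair; the event \<open>C \<times> C\<close> then says
    just that \<open>Z k\<close> lies in \<open>C\<close>.\<close>
  have "indep_var (N \<Otimes>\<^sub>M N) ((\<lambda>f. (f k, f k)) \<circ> (\<lambda>\<omega>. restrict (\<lambda>i. Z i \<omega>) {k})) (N \<Otimes>\<^sub>M N)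
      ((\<lambda>f. (f i, f j)) \<circ> (\<lambda>\<omega>. restrict (\<lambda>i. Z i \<omega>) {i, j}))"
    using ijk by (intro indep_var_compose[OF indep_var_restrict[OF ind]] comp) auto
  then have pair: "indep_var (N \<Otimes>\<^sub>M N) (\<lambda>\<omega>. (Z k \<omega>, Z k \<omega>)) (N \<Otimes>\<^sub>M N) (\<lambda>\<omega>. (Z i \<omega>, Z j \<omega>))"
    by (simp add: comp_def)
  have "C \<times> C \<in> sets (N \<Otimes>\<^sub>M N)" using C by simp
  note prod = indep_varD[OF pair this E]
  have "(\<lambda>\<omega>. ((Z k \<omega>, Z k \<omega>), (Z i \<omega>, Z j \<omega>))) -` ((C \<times> C) \<times> E) \<inter> space M
      = {\<omega> \<in> space M. Z k \<omega> \<in> C \<and> (Z i \<omega>, Z j \<omega>) \<in> E}"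
    "(\<lambda>\<omega>. (Z k \<omega>, Z k \<omega>)) -` (C \<times> C) \<inter> space M = {\<omega> \<in> space M. Z k \<omega> \<in> C}"
    "(\<lambda>\<omega>. (Z i \<omega>, Z j \<omega>)) -` E \<inter> space M = {\<omega> \<in> space M. (Z i \<omega>, Z j \<omega>) \<in> E}"
    by auto
  then show ?thesis using prod by (simp only:)
qed

text \<open>Asks of the law of \<open>U\<close> only a constant intensity \<open>c\<close>, so that
  the Poisson process of static users and the Cox process of mobile users are treated alike.\<close>

lemma (in prob_space) independent_mark_const:
  assumes U: "point_process M U" and X: "X \<in> measurable M N"
    and ind: "\<And>C E. C \<in> sets conf \<Longrightarrow> E \<in> sets N \<Longrightarrow>
      prob {\<omega> \<in> space M. U \<omega> \<in> C \<and> X \<omega> \<in> E} = prob {\<omega> \<in> space M. U \<omega> \<in> C} * prob {\<omega> \<in> space M. X \<omega> \<in> E}"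
    and mean: "\<And>A. A \<in> sets borel \<Longrightarrow> bounded A \<Longrightarrow> (\<integral>\<^sup>+\<omega>. of_nat (card (U \<omega> \<inter> A)) \<partial>M) = ennreal c * emeasure lborel A"
  shows "independent_mark M U X N (density lborel (\<lambda>_. ennreal c))"
proof -
  interpret sigma_finite_measure "density lborel (\<lambda>_. ennreal c)"
    by (subst sigma_finite_measure.sigma_finite_iff_density_finite[OF lborel.sigma_finite_measure_axioms]) auto
  have dens: "emeasure (density lborel (\<lambda>_. ennreal c)) A = ennreal c * emeasure lborel A" if "A \<in> sets borel" for A
    using that by (simp add: emeasure_density nn_integral_cmult_indicator)
  show ?thesis
  proof
    show "point_process M U" by fact
    show "X \<in> measurable M N" by fact
    show "sets (density lborel (\<lambda>_. ennreal c)) = sets borel" by simp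
    fix A :: "'b set" assume A: "A \<in> sets borel" "bounded A"
    show "(\<integral>\<^sup>+\<omega>. of_nat (card (U \<omega> \<inter> A)) \<partial>M) = emeasure (density lborel (\<lambda>_. ennreal c)) A"
      by (simp add: mean[OF A] dens[OF A(1)])
    show "emeasure (density lborel (\<lambda>_. ennreal c)) A < \<infinity>"
      using bounded_emeasure_lborel_finite[OF A(2,1)] by (simp add: dens[OF A(1)] ennreal_mult_less_top)
    fix E k assume E: "E \<in> sets N"
    let ?C = "{\<phi>. locally_finite \<phi> \<and> (\<forall>j<1::nat. card (\<phi> \<inter> A) = k)}"
    have C: "?C \<in> sets conf" using A by (intro count_window_sets_conf) auto
    have "U \<omega> \<in> ?C \<longleftrightarrow> card (U \<omega> \<inter> A) = k" if "\<omega> \<in> space M" for \<omega>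
      using U that by (auto simp: point_process_def locally_finite_def)
    then have "{\<omega> \<in> space M. U \<omega> \<in> ?C} = {\<omega> \<in> space M. card (U \<omega> \<inter> A) = k}"
      "{\<omega> \<in> space M. U \<omega> \<in> ?C \<and> X \<omega> \<in> E} = {\<omega> \<in> space M. card (U \<omega> \<inter> A) = k \<and> X \<omega> \<in> E}"
      by blast+
    then show "prob {\<omega> \<in> space M. card (U \<omega> \<inter> A) = k \<and> X \<omega> \<in> E} = prob {\<omega> \<in> space M. card (U \<omega> \<inter> A) = k} * prob {\<omega> \<in> space M. X \<omega> \<in> E}"
      using ind[OF C E] by (simp only:)
  qed
qed

lemma nn_integral_count_space_Collect:
  assumes "(\<integral>\<^sup>+x. indicator {x. P x} x \<partial>count_space U) \<noteq> \<infinity>"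
  shows "(\<integral>\<^sup>+x. indicator {x. P x} x \<partial>count_space U) = of_nat (card (U \<inter> {x. P x}))"
proof -
  have eq: "(\<integral>\<^sup>+x. indicator {x. P x} x \<partial>count_space U) = emeasure (count_space (U \<inter> {x. P x})) (U \<inter> {x. P x})"
    using nn_integral_count_space_restrict[of U "{x. P x}" "\<lambda>_. 1"] by simp
  have "finite (U \<inter> {x. P x})"
    using assms unfolding eq by (metis emeasure_count_space_infinite order_refl)
  then show ?thesis unfolding eq by simp
qed

text \<open>The finiteness hypothesis is needed because \<open>card\<close> of an infinite set is \<open>0\<close>.\<close>

lemma (in prob_space) expected_card_event:
  assumes U: "point_process M U" and X: "X \<in> measurable M N"
    and ind: "\<And>C E. C \<in> sets conf \<Longrightarrow> E \<in> sets N \<Longrightarrow>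
      prob {\<omega> \<in> space M. U \<omega> \<in> C \<and> X \<omega> \<in> E} = prob {\<omega> \<in> space M. U \<omega> \<in> C} * prob {\<omega> \<in> space M. X \<omega> \<in> E}"
    and mean: "\<And>A. A \<in> sets borel \<Longrightarrow> bounded A \<Longrightarrow> (\<integral>\<^sup>+\<omega>. of_nat (card (U \<omega> \<inter> A)) \<partial>M) = ennreal c * emeasure lborel A"
    and P: "Measurable.pred (borel \<Otimes>\<^sub>M N) (\<lambda>z. P (fst z) (snd z))"
    and finP: "(\<integral>\<^sup>+x. emeasure M {\<omega> \<in> space M. P x (X \<omega>)} \<partial>lborel) < \<infinity>"
  shows "(\<integral>\<^sup>+\<omega>. of_nat (card (U \<omega> \<inter> {x. P x (X \<omega>)})) \<partial>M)
       = ennreal c * (\<integral>\<^sup>+x. emeasure M {\<omega> \<in> space M. P x (X \<omega>)} \<partial>lborel)"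
proof -
  interpret independent_mark M U X N "density lborel (\<lambda>_. ennreal c)"
    using U X ind mean by (rule independent_mark_const)
  note [measurable] = X P
  have [measurable]: "Measurable.pred (borel \<Otimes>\<^sub>M M) (\<lambda>z. P (fst z) (X (snd z)))"
  proof -
    have "(\<lambda>z. (fst z, X (snd z))) \<in> measurable (borel \<Otimes>\<^sub>M M) (borel \<Otimes>\<^sub>M N)" by measurable
    from measurable_compose[OF this P] show ?thesis by simp
  qed
  let ?f = "\<lambda>z. indicator {z. P (fst z) (snd z)} z :: ennreal"
  have f: "?f \<in> borel_measurable (borel \<Otimes>\<^sub>M N)"
    using P by (intro borel_measurable_indicator') simp
  \<comment> \<open>The number of points with values up to infinity. Campbell's formula computes its
    mean; since that mean is finite, \<open>T\<close> is almost surely finite and then equals the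
    \<open>card\<close>.\<close>
  define T where "T \<omega> = (\<integral>\<^sup>+x. indicator {x. P x (X \<omega>)} x \<partial>count_space (U \<omega>))" for \<omega>
  have T_eq: "T \<omega> = (\<integral>\<^sup>+x. ?f (x, X \<omega>) \<partial>count_space (U \<omega>))" for \<omega>
    unfolding T_def by (intro nn_integral_cong) (simp add: indicator_def)
  have T[measurable]: "T \<in> borel_measurable M"
  proof -
    have "(\<lambda>\<omega>. \<integral>\<^sup>+x. indicator {z. P (fst z) (X (snd z))} (x, \<omega>) \<partial>count_space (U \<omega>)) \<in> borel_measurable M"
      by (intro sum_points_measurable[OF U] borel_measurable_indicator') simp
    moreover have "T \<omega> = (\<integral>\<^sup>+x. indicator {z. P (fst z) (X (snd z))} (x, \<omega>) \<partial>count_space (U \<omega>))" for \<omega>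
      unfolding T_def by (intro nn_integral_cong) (simp add: indicator_def)
    ultimately show ?thesis by (simp cong: measurable_cong)
  qed
  have Pm: "{\<omega> \<in> space M. P x (X \<omega>)} \<in> events" for x
  proof -
    have "(\<lambda>\<omega>. (x, X \<omega>)) \<in> measurable M (borel \<Otimes>\<^sub>M N)" by measurable
    from measurable_compose[OF this P] show ?thesis by simp
  qed
  have "(\<integral>\<^sup>+\<omega>. T \<omega> \<partial>M) = (\<integral>\<^sup>+x. \<integral>\<^sup>+\<omega>. ?f (x, X \<omega>) \<partial>M \<partial>density lborel (\<lambda>_. ennreal c))"
    unfolding T_eq by (rule campbell[OF f])
  also have "\<dots> = (\<integral>\<^sup>+x. emeasure M {\<omega> \<in> space M. P x (X \<omega>)} \<partial>density lborel (\<lambda>_. ennreal c))"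
  proof (intro nn_integral_cong)
    fix x
    have "(\<integral>\<^sup>+\<omega>. ?f (x, X \<omega>) \<partial>M) = (\<integral>\<^sup>+\<omega>. indicator {\<omega> \<in> space M. P x (X \<omega>)} \<omega> \<partial>M)"
      by (intro nn_integral_cong) (simp add: indicator_def)
    then show "(\<integral>\<^sup>+\<omega>. ?f (x, X \<omega>) \<partial>M) = emeasure M {\<omega> \<in> space M. P x (X \<omega>)}"
      using Pm by simp
  qed
  also have "\<dots> = ennreal c * (\<integral>\<^sup>+x. emeasure M {\<omega> \<in> space M. P x (X \<omega>)} \<partial>lborel)"
  proof -
    have "(\<lambda>x. \<integral>\<^sup>+\<omega>. ?f (x, X \<omega>) \<partial>M) \<in> borel_measurable borel"
      using f by measurable
    moreover have "(\<integral>\<^sup>+\<omega>. ?f (x, X \<omega>) \<partial>M) = emeasure M {\<omega> \<in> space M. P x (X \<omega>)}" for x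
    proof -
      have "(\<integral>\<^sup>+\<omega>. ?f (x, X \<omega>) \<partial>M) = (\<integral>\<^sup>+\<omega>. indicator {\<omega> \<in> space M. P x (X \<omega>)} \<omega> \<partial>M)"
        by (intro nn_integral_cong) (simp add: indicator_def)
      then show ?thesis using Pm by simp
    qed
    ultimately have "(\<lambda>x. emeasure M {\<omega> \<in> space M. P x (X \<omega>)}) \<in> borel_measurable lborel"
      by simp
    then show ?thesis by (simp add: nn_integral_density nn_integral_cmult)
  qed
  finally have int_T: "(\<integral>\<^sup>+\<omega>. T \<omega> \<partial>M) = ennreal c * (\<integral>\<^sup>+x. emeasure M {\<omega> \<in> space M. P x (X \<omega>)} \<partial>lborel)" .
  then have "(\<integral>\<^sup>+\<omega>. T \<omega> \<partial>M) \<noteq> \<infinity>"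
    using finP by (simp add: ennreal_mult_eq_top_iff)
  then have "AE \<omega> in M. T \<omega> \<noteq> \<infinity>"
    by (intro nn_integral_noteq_infinite T)
  then have "(\<integral>\<^sup>+\<omega>. of_nat (card (U \<omega> \<inter> {x. P x (X \<omega>)})) \<partial>M) = (\<integral>\<^sup>+\<omega>. T \<omega> \<partial>M)"
  proof (intro nn_integral_cong_AE, elim AE_mp, intro AE_I2 impI)
    fix \<omega> assume "T \<omega> \<noteq> \<infinity>"
    then show "of_nat (card (U \<omega> \<inter> {x. P x (X \<omega>)})) = T \<omega>"
      unfolding T_def by (rule nn_integral_count_space_Collect[symmetric])
  qed
  then show ?thesis using int_T by simp
qed

section \<open>Comparison of the two means\<close>

theorem theorem8:
  fixes M :: "'w measure"
    and Mac Mic Us Um :: "'w \<Rightarrow> point set"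
    and L :: "'w \<Rightarrow> (real \<times> real) set"
    and lamBS p Pmac Pmic \<beta> lamSU lamL lamMU :: real
  assumes "prob_space M"
    and "lamBS > 0" and "0 < p" and "p \<le> 1" and "Pmac > 0" and "Pmic \<ge> 0" and "\<beta> > 2"
    and "lamSU > 0" and "lamL > 0" and "lamMU > 0"
    and "hom_ppp M Mac (p * lamBS)"
    and "hom_ppp M Mic ((1 - p) * lamBS)"
    and "hom_ppp M Us lamSU"
    and "hom_plp M L lamL"
    and "cox_on_lines M L Um lamMU"
    and "prob_space.indep_sets M
           (\<lambda>i::nat. if i = 0 then count_events M Mac else if i = 1 then count_events M Mic
                     else if i = 2 then count_events M Us else joint_count_events M L Um) {0..3}"
  shows "(\<integral>\<^sup>+\<omega>. of_nat (card (Um \<omega> \<inter> voronoi (Mac \<omega>) (closest (Mac \<omega>))))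
               * indicator (hetcell (Mac \<omega>) (Mic \<omega>) Pmac Pmic \<beta> (closest (Mac \<omega>))) (0, 0) \<partial>M)
       = ennreal (lamL * lamMU / lamSU) *
         (\<integral>\<^sup>+\<omega>. of_nat (card (Us \<omega> \<inter> hetcell (Mac \<omega>) (Mic \<omega>) Pmac Pmic \<beta> (closest (Mac \<omega>)))) \<partial>M)"
proof -
  interpret prob_space M by fact
  note ppp = \<open>hom_ppp M Mac (p * lamBS)\<close> \<open>hom_ppp M Mic ((1 - p) * lamBS)\<close> \<open>hom_ppp M Us lamSU\<close>
  have lam: "0 < p * lamBS" using assms by simp
  have \<beta>: "0 < \<beta>" using assms by simp
  have pp: "point_process M Mac" "point_process M Mic" "point_process M Us" "point_process M Um"
    using ppp \<open>cox_on_lines M L Um lamMU\<close> by (simp_all add: hom_ppp_def poisson_pp_def cox_on_lines_def)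
  \<comment> \<open>Of the joint family for lines and mobile users only \<open>Um\<close> is kept;
    the lines enter separately through the mean of \<open>Um\<close>.\<close>
  define Z where "Z i = (if i = 0 then Mac else if i = 1 then Mic else if i = 2 then Us else Um)" for i :: nat
  have indZ: "indep_vars (\<lambda>_. conf) Z {0..3}"
  proof (rule indep_vars_point_processes)
    show "point_process M (Z i)" for i using pp by (simp add: Z_def)
    have "count_events M Um \<subseteq> joint_count_events M L Um"
    proof
      fix a assume "a \<in> count_events M Um"
      then obtain n :: nat and A k where "a = {\<omega> \<in> space M. \<forall>i<n. card (Um \<omega> \<inter> A i) = k i}"
        "\<forall>i<n. A i \<in> sets borel \<and> bounded (A i)"
        unfolding count_events_def mem_Collect_eq by blast
      \<comment> \<open>A count event of \<open>Um\<close> is a joint one with no window for the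
        lines.\<close>
      then show "a \<in> joint_count_events M L Um"
        unfolding joint_count_events_def mem_Collect_eq
        by (intro exI[of _ "0::nat"] exI[of _ "\<lambda>_. {}"] exI[of _ "\<lambda>_. 0"] exI[of _ n] exI[of _ A] exI[of _ k]) simp
    qed
    then show "indep_sets (\<lambda>i. count_events M (Z i)) {0..3}"
      by (intro indep_sets_mono_sets[OF assms(16)]) (simp add: Z_def)
  qed
  have ind_stations: "indep_var conf Mac conf Mic"
    using indep_vars_imp_indep_var[OF indZ, of 0 1] by (simp add: Z_def)
  have [measurable]: "Mac \<in> measurable M conf" "Mic \<in> measurable M conf"
    using pp by (simp_all add: point_process_iff)
  define X where "X = (\<lambda>\<omega>. (Mac \<omega>, Mic \<omega>))"
  have X[measurable]: "X \<in> measurable M (conf \<Otimes>\<^sub>M conf)" unfolding X_def by measurable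
  have indS: "prob {\<omega> \<in> space M. Us \<omega> \<in> C \<and> X \<omega> \<in> E} = prob {\<omega> \<in> space M. Us \<omega> \<in> C} * prob {\<omega> \<in> space M. X \<omega> \<in> E}"
    and indM: "prob {\<omega> \<in> space M. Um \<omega> \<in> C \<and> X \<omega> \<in> E} = prob {\<omega> \<in> space M. Um \<omega> \<in> C} * prob {\<omega> \<in> space M. X \<omega> \<in> E}"
    if "C \<in> sets conf" "E \<in> sets (conf \<Otimes>\<^sub>M conf)" for C E
    using indep_vars_prob_pair[OF indZ, of 0 1 2 C E] indep_vars_prob_pair[OF indZ, of 0 1 3 C E] that
    by (simp_all add: Z_def X_def)
  let ?D1 = "macro_event Pmac Pmic \<beta>" and ?D2 = "het_event Pmac Pmic \<beta>"

  have D_meas: "{\<Phi> \<in> space (conf \<Otimes>\<^sub>M conf). ?D2 x \<Phi>} \<in> sets (conf \<Otimes>\<^sub>M conf)" for x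
  proof -
    have "(\<lambda>\<Phi>. (x, \<Phi>)) \<in> measurable (conf \<Otimes>\<^sub>M conf) (borel \<Otimes>\<^sub>M (conf \<Otimes>\<^sub>M conf))" by measurable
    from measurable_compose[OF this het_event_measurable[of Pmac Pmic \<beta>]] show ?thesis by simp
  qed
  \<comment> \<open>The reflection depends on \<open>x\<close>; this is harmless because laws are
    compared for each fixed \<open>x\<close> separately, before integrating.\<close>
  have transport: "emeasure M {\<omega> \<in> space M. ?D1 x (X \<omega>)} = emeasure M {\<omega> \<in> space M. ?D2 x (X \<omega>)}" for x
  proof -
    let ?R = "\<lambda>\<phi>. (\<lambda>y. x - y) ` \<phi>"
    let ?D = "{\<Phi> \<in> space (conf \<Otimes>\<^sub>M conf). ?D2 x \<Phi>}"
    have [measurable]: "?R \<in> measurable conf conf" by (rule reflect_conf_measurable)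
    have XR: "(\<lambda>\<omega>. (?R (Mac \<omega>), ?R (Mic \<omega>))) \<in> measurable M (conf \<Otimes>\<^sub>M conf)" by measurable
    have "emeasure M {\<omega> \<in> space M. ?D1 x (X \<omega>)} = emeasure M ((\<lambda>\<omega>. (?R (Mac \<omega>), ?R (Mic \<omega>))) -` ?D \<inter> space M)"
      using measurable_space[OF XR] assms(5) \<beta>
      by (intro arg_cong[where f="emeasure M"]) (auto simp: X_def het_event_reflect)
    also have "\<dots> = emeasure (distr M (conf \<Otimes>\<^sub>M conf) (\<lambda>\<omega>. (?R (Mac \<omega>), ?R (Mic \<omega>)))) ?D"
      by (rule emeasure_distr[OF XR D_meas, symmetric])
    also have "\<dots> = emeasure (distr M (conf \<Otimes>\<^sub>M conf) X) ?D"
      unfolding X_def by (simp only: hom_ppp_pair_reflect[OF ppp(1,2) ind_stations])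
    also have "\<dots> = emeasure M (X -` ?D \<inter> space M)"
      by (rule emeasure_distr[OF _ D_meas]) measurable
    also have "\<dots> = emeasure M {\<omega> \<in> space M. ?D2 x (X \<omega>)}"
      using measurable_space[of X M "conf \<Otimes>\<^sub>M conf"]
      by (intro arg_cong[where f="emeasure M"]) auto
    finally show ?thesis .
  qed
  \<comment> \<open>Finiteness is checked for \<open>?D2\<close>, which is bounded by an event of
    the macro stations alone, and carried over to \<open>?D1\<close> by
    \<open>transport\<close>.\<close>
  have "(\<integral>\<^sup>+x. emeasure M {\<omega> \<in> space M. ?D2 x (X \<omega>)} \<partial>lborel)
      \<le> (\<integral>\<^sup>+x. ennreal 2 * ennreal (exp (- (p * lamBS * pi / 4 * (norm (x::point))\<^sup>2))) \<partial>lborel)"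
  proof (intro nn_integral_mono)
    fix x :: point
    have "Measurable.pred M (\<lambda>\<omega>. \<exists>y\<in>Mac \<omega>. (0, 0) \<in> voronoi (Mac \<omega>) y \<and> x \<in> voronoi (Mac \<omega>) y)"
      by (rule conf_bex_measurable) measurable
    then have "emeasure M {\<omega> \<in> space M. ?D2 x (X \<omega>)}
        \<le> emeasure M {\<omega> \<in> space M. \<exists>y\<in>Mac \<omega>. (0, 0) \<in> voronoi (Mac \<omega>) y \<and> x \<in> voronoi (Mac \<omega>) y}"
      using het_event_imp[OF assms(5) \<beta>, of Pmic x "X _"] by (intro emeasure_mono) (auto simp: X_def)
    also have "\<dots> \<le> ennreal (2 * exp (- (p * lamBS * pi / 4 * (norm x)\<^sup>2)))"
      by (rule hom_ppp_common_voronoi_prob) fact+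
    finally show "emeasure M {\<omega> \<in> space M. ?D2 x (X \<omega>)} \<le> ennreal 2 * ennreal (exp (- (p * lamBS * pi / 4 * (norm x)\<^sup>2)))"
      by (simp only: ennreal_mult[symmetric] exp_ge_zero zero_le_numeral)
  qed
  also have "\<dots> < \<infinity>"
    using nn_integral_gaussian_finite[of "p * lamBS * pi / 4"] lam
    by (subst nn_integral_cmult) (auto simp: ennreal_mult_less_top)
  finally have fin: "(\<integral>\<^sup>+x. emeasure M {\<omega> \<in> space M. ?D2 x (X \<omega>)} \<partial>lborel) < \<infinity>" .
  then have fin1: "(\<integral>\<^sup>+x. emeasure M {\<omega> \<in> space M. ?D1 x (X \<omega>)} \<partial>lborel) < \<infinity>"
    unfolding transport .

  have meanS: "(\<integral>\<^sup>+\<omega>. of_nat (card (Us \<omega> \<inter> A)) \<partial>M) = ennreal lamSU * emeasure lborel A"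
    if A: "A \<in> sets borel" "bounded A" for A
    using poisson_pp_mean[OF assms(1) ppp(3)[unfolded hom_ppp_def] A] bounded_emeasure_lborel_finite[OF A(2,1)] assms(8)
    by (simp add: ennreal_mult emeasure_eq_ennreal_measure)
  have meanM: "(\<integral>\<^sup>+\<omega>. of_nat (card (Um \<omega> \<inter> A)) \<partial>M) = ennreal (lamL * lamMU) * emeasure lborel A"
    if A: "A \<in> sets borel" "bounded A" for A
    using assms by (intro cox_mean[OF assms(1,14) _ _ assms(15) A]) simp_all

  \<comment> \<open>Almost surely only the closest station can witness the existentials. An almost
    sure equivalence is enough to rewrite the integrands, and it avoids any measurability claim
    about \<open>closest\<close>.\<close>
  have D_cell: "AE \<omega> in M. (\<forall>x. ?D1 x (X \<omega>) \<longleftrightarrow> x \<in> voronoi (Mac \<omega>) (closest (Mac \<omega>)) \<and>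
          (0, 0) \<in> hetcell (Mac \<omega>) (Mic \<omega>) Pmac Pmic \<beta> (closest (Mac \<omega>))) \<and>
      (\<forall>x. ?D2 x (X \<omega>) \<longleftrightarrow> x \<in> hetcell (Mac \<omega>) (Mic \<omega>) Pmac Pmic \<beta> (closest (Mac \<omega>)))"
    using AE_space hom_ppp_AE_nonempty[OF assms(1) ppp(1) lam] hom_ppp_AE_norm_inj[OF assms(1) ppp(1) lam]
  proof eventually_elim
    case (elim \<omega>)
    have "locally_finite (Mac \<omega>)"
      using point_process_finite[OF pp(1) elim(1)] by (simp add: locally_finite_def)
    note c = closest_unique[OF this elim(2) elim(3)]
    have "(\<exists>y\<in>Mac \<omega>. (0, 0) \<in> voronoi (Mac \<omega>) y \<and> Q y) \<longleftrightarrow> Q (closest (Mac \<omega>))" for Q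
      using c by metis
    then show ?case
      by (simp add: macro_event_def het_event_def X_def)
  qed
  have "(\<integral>\<^sup>+\<omega>. of_nat (card (Um \<omega> \<inter> voronoi (Mac \<omega>) (closest (Mac \<omega>))))
               * indicator (hetcell (Mac \<omega>) (Mic \<omega>) Pmac Pmic \<beta> (closest (Mac \<omega>))) (0, 0) \<partial>M)
      = (\<integral>\<^sup>+\<omega>. of_nat (card (Um \<omega> \<inter> {x. ?D1 x (X \<omega>)})) \<partial>M)"
  proof (rule nn_integral_cong_AE, rule AE_mp[OF D_cell], rule AE_I2, rule impI)
    fix \<omega>
    let ?x = "closest (Mac \<omega>)"
    assume "(\<forall>x. ?D1 x (X \<omega>) \<longleftrightarrow> x \<in> voronoi (Mac \<omega>) ?x \<and> (0, 0) \<in> hetcell (Mac \<omega>) (Mic \<omega>) Pmac Pmic \<beta> ?x) \<and>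
      (\<forall>x. ?D2 x (X \<omega>) \<longleftrightarrow> x \<in> hetcell (Mac \<omega>) (Mic \<omega>) Pmac Pmic \<beta> ?x)"
    \<comment> \<open>If the origin lies outside the hetnet cell, the event fails for every point
      and both sides are 0; otherwise it describes the Voronoi cell.\<close>
    then show "of_nat (card (Um \<omega> \<inter> voronoi (Mac \<omega>) ?x)) * indicator (hetcell (Mac \<omega>) (Mic \<omega>) Pmac Pmic \<beta> ?x) (0, 0)
        = (of_nat (card (Um \<omega> \<inter> {x. ?D1 x (X \<omega>)})) :: ennreal)"
      by (cases "(0, 0) \<in> hetcell (Mac \<omega>) (Mic \<omega>) Pmac Pmic \<beta> ?x") (simp_all del: split_paired_All)
  qed
  also have "\<dots> = ennreal (lamL * lamMU) * (\<integral>\<^sup>+x. emeasure M {\<omega> \<in> space M. ?D1 x (X \<omega>)} \<partial>lborel)"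
    by (rule expected_card_event[OF pp(4) X indM meanM macro_event_measurable fin1])
  also have "\<dots> = ennreal (lamL * lamMU / lamSU) * (ennreal lamSU * (\<integral>\<^sup>+x. emeasure M {\<omega> \<in> space M. ?D2 x (X \<omega>)} \<partial>lborel))"
    using assms(8-10) by (simp add: transport mult.assoc[symmetric] flip: ennreal_mult)
  also have "ennreal lamSU * (\<integral>\<^sup>+x. emeasure M {\<omega> \<in> space M. ?D2 x (X \<omega>)} \<partial>lborel)
      = (\<integral>\<^sup>+\<omega>. of_nat (card (Us \<omega> \<inter> {x. ?D2 x (X \<omega>)})) \<partial>M)"
    by (rule expected_card_event[symmetric, OF pp(3) X indS meanS het_event_measurable fin])
  also have "\<dots> = (\<integral>\<^sup>+\<omega>. of_nat (card (Us \<omega> \<inter> hetcell (Mac \<omega>) (Mic \<omega>) Pmac Pmic \<beta> (closest (Mac \<omega>)))) \<partial>M)"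
    by (rule nn_integral_cong_AE, rule AE_mp[OF D_cell]) (simp del: split_paired_All)
  finally show ?thesis .
qed

end
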